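(* Let $j>0$, $u\in L^\infty([0,1],\mathbb R_+)$ with $F(0;u)>0$. Then $$S^{(\delta,-)}_t(u)\le S^{(\delta',+)}_t(u)$$ for all $\delta,\delta'>0$ and $t$ such that $u\in\mathcal U_\delta\cap\mathcal U_{\delta'}$ and $t=k\delta=k'\delta'$ with $k,k'\in\mathbb N$, where $\le$ is the order of mass transport defined below.
   Context: For a positive Borel measure $\mu$ on $[0,1]$ let $F(r;\mu)=\mu([r,1])$ (for a density $u$, $F(r;u)=\int_r^1u$). $\mathcal U$ is the set of positive measures $u=c_uD_0+\rho_u(r)dr$ with $c_u\ge0$, $\rho_u\in L^\infty([0,1],\mathbb R_+)$, $D_0$ the Dirac mass at $0$. For $u,v\in\mathcal U$, $u\le v$ iff $F(r;u)\le F(r;v)$ for all $r\in[0,1]$. For $\delta>0$, $\mathcal U_\delta=\{u=c_uD_0+\rho_u\in\mathcal U:F(0;\rho_u)>j\delta\}$ and the cut-and-paste operator $K^{(\delta)}:\mathcal U_\delta\to\mathcal U$ is $K^{(\delta)}u=j\delta D_0+\mathbf 1_{[0,R_\delta(u)]}u$, $R_\delta(u)=\inf\{r:F(r;u)=j\delta\}$. $G^{\rm neum}_t(r,r')=\sum_kG_t(r,r'_k)$, $G_t(r,r')=e^{-(r-r')^2/2t}/\sqrt{2\pi t}$, where $r'_k$ are the images of $r'$ under repeated reflections of $[0,1]$ to the right and left (heat kernel of $\partial_t=\frac12\partial_r^2$ on $[0,1]$ with Neumann boundary conditions); $G^{\rm neum}_t*\mu(r)=\int G^{\rm neum}_t(r,r')\mu(dr')$.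 Barriers: for $u\in L^\infty([0,1],\mathbb R_+)$ with $F(0;u)>j\delta$, set $S^{(\delta,\pm)}_0(u)=u$ and for $n\ge1$: $S^{(\delta,-)}_{n\delta}(u)=K^{(\delta)}G^{\rm neum}_\delta*S^{(\delta,-)}_{(n-1)\delta}(u)$, $S^{(\delta,+)}_{n\delta}(u)=G^{\rm neum}_\delta*K^{(\delta)}S^{(\delta,+)}_{(n-1)\delta}(u)$. *)

theory Defs
  imports "HOL-Analysis.Analysis"
begin

text \<open>An element of the class U, u = c_u D_0 + rho_u(r) dr, is represented by the
pair (c_u, rho_u).  Only the values of rho_u on [0,1] matter.\<close>

type_synonym umeas = "real \<times> (real \<Rightarrow> real)"

definition Fm :: "real \<Rightarrow> umeas \<Rightarrow> real" where
  "Fm r u = (if 0 \<in> {r..1} then fst u else 0) + (LINT x:{r..1}|lborel. snd u x)"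

definition mt_le :: "umeas \<Rightarrow> umeas \<Rightarrow> bool" where
  "mt_le u v \<longleftrightarrow> (\<forall>r\<in>{0..1}. Fm r u \<le> Fm r v)"

definition Gker :: "real \<Rightarrow> real \<Rightarrow> real \<Rightarrow> real" where
  "Gker t r r' = exp (- ((r - r')\<^sup>2) / (2 * t)) / sqrt (2 * pi * t)"

text \<open>Neumann heat kernel on [0,1]: the images of r' under repeated reflections
are r' + 2k and 2k - r', k an integer.\<close>
definition Gneum :: "real \<Rightarrow> real \<Rightarrow> real \<Rightarrow> real" where
  "Gneum t r r' = (\<Sum>\<^sub>\<infinity>k::int. Gker t r (r' + 2 * of_int k) + Gker t r (2 * of_int k - r'))"

definition heat :: "real \<Rightarrow> umeas \<Rightarrow> umeas" where
  "heat t u = (0, \<lambda>r. fst u * Gneum t r 0 + (LINT r':{0..1}|lborel. Gneum t r r' * snd u r'))"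

definition Rcut :: "real \<Rightarrow> real \<Rightarrow> umeas \<Rightarrow> real" where
  "Rcut j \<delta> u = Inf {r \<in> {0..1}. Fm r u = j * \<delta>}"

definition Kcut :: "real \<Rightarrow> real \<Rightarrow> umeas \<Rightarrow> umeas" where
  "Kcut j \<delta> u = (j * \<delta> + fst u, \<lambda>r. indicator {0..Rcut j \<delta> u} r * snd u r)"

primrec Sminus :: "real \<Rightarrow> real \<Rightarrow> nat \<Rightarrow> (real \<Rightarrow> real) \<Rightarrow> umeas" where
  "Sminus j \<delta> 0 u = (0, u)"
| "Sminus j \<delta> (Suc n) u = Kcut j \<delta> (heat \<delta> (Sminus j \<delta> n u))"

primrec Splus :: "real \<Rightarrow> real \<Rightarrow> nat \<Rightarrow> (real \<Rightarrow> real) \<Rightarrow> umeas" where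
  "Splus j \<delta> 0 u = (0, u)"
| "Splus j \<delta> (Suc n) u = heat \<delta> (Kcut j \<delta> (Splus j \<delta> n u))"

end

(* Replace a measure u of mass M by its profile F(r) = F(r;u) on (0,1).  The odd 2-periodic
   extension of F(r) - M (1 - r) evolves under the Neumann heat semigroup by Gaussian convolution
   on the real line, and the cut is F |-> max (F - j delta) 0, so that heat steps compose and cuts
   compose.  Heat is monotone: on a nonnegative difference of profiles a step of length s loses at
   most O(s^2) of positivity, so splitting time t into n steps and letting n tend to infinity
   loses nothing.  A cut changes a profile by at most j delta and the convolution is a sup-norm
   contraction, so heating and then cutting gives at most what cutting and then heating gives:
   C H <= H C.  With eps = t / (k k') both barriers are words in H_eps and C_eps, and performing
   cuts later decreases the result. *)
theory Submission
  imports Defs "HOL-Probability.Probability"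
begin

section \<open>Gaussian convolution on the line\<close>

text \<open>The profile is the right unknown because the Neumann condition on the density becomes a
  Dirichlet condition on \<open>F(r) - M * (1 - r)\<close>: heat keeps F(0) = M and F(1) = 0, and
  the linear part is stationary. A Dirichlet solution extends oddly across both walls, which removes
  the boundary. The obstacle is positivity. With two walls the profile kernel is an alternating sum
  of image Gaussians, whose sign is not visible term by term. With one wall the kernel is the
  difference of two Gaussians and its sign is plain, so only the nearer wall is used, and the
  oddness at the far wall enters only through the reflection x -> 1 - x. The order of the error
  matters: n steps of length t / n lose n * O((t / n)^2), which tends to 0. A second moment would
  give O(s) per step, and the total loss would not vanish; hence the fourth moment. An atom at 0 is
  invisible to a profile on (0,1) and is remembered only through the mass \<open>M\<close>. Both
  operators conserve \<open>M\<close>, so two barriers started from the same density are always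
  compared at equal mass.\<close>

abbreviation gauss :: "real \<Rightarrow> real \<Rightarrow> real" where
  "gauss s \<equiv> normal_density 0 (sqrt s)"

definition Gconv :: "real \<Rightarrow> (real \<Rightarrow> real) \<Rightarrow> real \<Rightarrow> real" where
  "Gconv s p x = (LINT z|lborel. gauss s z * p (x + z))"

lemma gauss_minus: "gauss s (- z) = gauss s z"
  by (simp add: normal_density_def)

lemma gauss_abs_mono: "\<bar>z\<bar> \<le> \<bar>w\<bar> \<Longrightarrow> s > 0 \<Longrightarrow> gauss s w \<le> gauss s z"
  by (auto simp: normal_density_def abs_le_square_iff divide_right_mono mult_left_mono)

lemma integrable_gauss_bounded:
  fixes p :: "real \<Rightarrow> real"
  assumes "s > 0" and [measurable]: "p \<in> borel_measurable borel" and "\<And>x. \<bar>p x\<bar> \<le> B"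
  shows "integrable lborel (\<lambda>z. gauss s z * p z)"
proof (rule Bochner_Integration.integrable_bound)
  show "integrable lborel (\<lambda>z. gauss s z * B)"
    using assms(1) by (intro integrable_mult_left) auto
  show "AE z in lborel. norm (gauss s z * p z) \<le> norm (gauss s z * B)"
    using assms(3) by (intro AE_I2) (auto simp: abs_mult intro!: mult_left_mono order_trans[OF assms(3) abs_ge_self])
qed measurable

lemma integrable_Gconv:
  fixes p :: "real \<Rightarrow> real"
  assumes "s > 0" and [measurable]: "p \<in> borel_measurable borel" and "\<And>x. \<bar>p x\<bar> \<le> B"
  shows "integrable lborel (\<lambda>z. gauss s z * p (x + z))"
  using assms(3) by (intro integrable_gauss_bounded[OF assms(1)]) auto

lemma Gconv_diff:
  fixes p q :: "real \<Rightarrow> real"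
  assumes "s > 0" "p \<in> borel_measurable borel" "\<And>x. \<bar>p x\<bar> \<le> B"
    and "q \<in> borel_measurable borel" "\<And>x. \<bar>q x\<bar> \<le> B'"
  shows "Gconv s (\<lambda>x. p x - q x) x = Gconv s p x - Gconv s q x"
  using Bochner_Integration.integral_diff[OF integrable_Gconv[OF assms(1-3), of x] integrable_Gconv[OF assms(1,4,5), of x]]
  by (simp add: Gconv_def right_diff_distrib)

lemma abs_Gconv_le:
  fixes p :: "real \<Rightarrow> real"
  assumes "s > 0" and "p \<in> borel_measurable borel" and "\<And>x. \<bar>p x\<bar> \<le> B"
  shows "\<bar>Gconv s p x\<bar> \<le> B"
proof -
  have "B \<ge> 0"
    using assms(3)[of 0] by linarith
  then have "\<bar>Gconv s p x\<bar> \<le> (LINT z|lborel. gauss s z * B)"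
    unfolding Gconv_def
    using assms by (intro integral_abs_bound_integral integrable_Gconv[where B = B])
      (auto simp: abs_mult intro!: mult_left_mono)
  also have "\<dots> = B"
    using assms(1) by simp
  finally show ?thesis .
qed

lemma borel_measurable_Gconv[measurable]:
  assumes [measurable]: "p \<in> borel_measurable borel"
  shows "Gconv s p \<in> borel_measurable borel"
  unfolding Gconv_def by measurable

lemma Gconv_minus:
  assumes "\<And>x. p (c - x) = - p x"
  shows "Gconv s p (c - x) = - Gconv s p x"
proof -
  have "Gconv s p (c - x) = (LINT z|lborel. gauss s (- z) * p (c - x + - z))"
    unfolding Gconv_def
    by (subst lborel_integral_real_affine[where c = "-1" and t = 0]) auto
  also have "\<dots> = (LINT z|lborel. - (gauss s z * p (x + z)))"
    using assms[of "x + _"] by (auto simp: gauss_minus algebra_simps)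
  finally show ?thesis
    by (simp add: Gconv_def)
qed

lemma Gconv_reflect: "Gconv s (\<lambda>x. p (c - x)) x = Gconv s p (c - x)"
proof -
  have "Gconv s p (c - x) = (LINT z|lborel. gauss s (- z) * p (c - x + - z))"
    unfolding Gconv_def
    by (subst lborel_integral_real_affine[where c = "-1" and t = 0]) auto
  then show ?thesis
    by (simp add: Gconv_def gauss_minus algebra_simps)
qed

lemma Gconv_shift: "Gconv s p x = (LINT y|lborel. gauss s (y - x) * p y)"
  unfolding Gconv_def
  by (subst (2) lborel_integral_real_affine[where c = 1 and t = x]) auto

lemma Gconv_periodic:
  assumes "\<And>x. p (x + c) = p x"
  shows "Gconv s p (x + c) = Gconv s p x"
  using assms[of "x + _"] by (simp add: Gconv_def algebra_simps)

text \<open>Variances of independent centred normal variables add; \<open>s\<close> is the variance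
  and hence the heat time for half the Laplacian.\<close>

lemma gauss_convolution:
  assumes "s > 0" "t > 0"
  shows "(LINT z|lborel. gauss s z * gauss t (v - z)) = gauss (s + t) v"
proof -
  have "(\<integral>\<^sup>+z. ennreal (gauss s z * gauss t (v - z)) \<partial>lborel) = ennreal (gauss (s + t) v)"
    using fun_cong[OF conv_normal_density_zero_mean[of "sqrt t" "sqrt s"], of v] assms
    by (simp add: mult.commute add.commute)
  then show ?thesis
    by (subst integral_eq_nn_integral) auto
qed

lemma Gconv_Gconv:
  fixes p :: "real \<Rightarrow> real"
  assumes st: "s > 0" "t > 0" and [measurable]: "p \<in> borel_measurable borel" and B: "\<And>x. \<bar>p x\<bar> \<le> B"
  shows "Gconv s (Gconv t p) x = Gconv (s + t) p x"
proof -
  have nn: "(\<integral>\<^sup>+v. ennreal (gauss t (v - z)) \<partial>lborel) = 1" for z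
  proof -
    have "(\<integral>\<^sup>+v. ennreal (gauss t (v - z)) \<partial>lborel) = (\<integral>\<^sup>+v. ennreal (gauss t v) \<partial>lborel)"
      by (subst (2) nn_integral_real_affine[where c = 1 and t = "- z"]) auto
    also have "\<dots> = 1"
      using st by (subst nn_integral_eq_integral) auto
    finally show ?thesis .
  qed
  have B0: "B \<ge> 0"
    using B[of 0] by linarith
  have int: "integrable (lborel \<Otimes>\<^sub>M lborel) (\<lambda>(z, v). gauss s z * (gauss t (v - z) * p (x + v)))"
  proof (rule integrableI_bounded)
    show "(\<lambda>(z, v). gauss s z * (gauss t (v - z) * p (x + v))) \<in> borel_measurable (lborel \<Otimes>\<^sub>M lborel)"
      by measurable
    have "(\<integral>\<^sup>+w. ennreal (norm (case w of (z, v) \<Rightarrow> gauss s z * (gauss t (v - z) * p (x + v)))) \<partial>(lborel \<Otimes>\<^sub>M lborel))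
       \<le> (\<integral>\<^sup>+w. (case w of (z, v) \<Rightarrow> ennreal B * ennreal (gauss s z) * ennreal (gauss t (v - z))) \<partial>(lborel \<Otimes>\<^sub>M lborel))"
    proof (intro nn_integral_mono, clarify)
      fix z v :: real
      have "gauss s z * gauss t (v - z) * \<bar>p (x + v)\<bar> \<le> gauss s z * gauss t (v - z) * B"
        using B by (intro mult_left_mono) auto
      then show "ennreal (norm (gauss s z * (gauss t (v - z) * p (x + v)))) \<le> ennreal B * ennreal (gauss s z) * ennreal (gauss t (v - z))"
        using B0 by (auto simp: ennreal_mult[symmetric] abs_mult mult_ac intro!: ennreal_leI)
    qed
    also have "\<dots> = (\<integral>\<^sup>+z. \<integral>\<^sup>+v. ennreal B * ennreal (gauss s z) * ennreal (gauss t (v - z)) \<partial>lborel \<partial>lborel)"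
      by (subst lborel.nn_integral_fst[symmetric]) auto
    also have "\<dots> = (\<integral>\<^sup>+z. ennreal B * ennreal (gauss s z) \<partial>lborel)"
      by (simp add: nn_integral_cmult nn)
    also have "\<dots> = ennreal B"
      using st by (subst nn_integral_cmult) (auto simp: nn_integral_eq_integral)
    finally show "(\<integral>\<^sup>+w. ennreal (norm (case w of (z, v) \<Rightarrow> gauss s z * (gauss t (v - z) * p (x + v)))) \<partial>(lborel \<Otimes>\<^sub>M lborel)) < \<infinity>"
      by (simp add: le_less_trans)
  qed
  have "Gconv t p (x + z) = (LINT v|lborel. gauss t (v - z) * p (x + v))" for z
    unfolding Gconv_shift[of t p "x + z"]
    by (subst lborel_integral_real_affine[where c = 1 and t = x]) auto
  then have "Gconv s (Gconv t p) x = (LINT z|lborel. LINT v|lborel. gauss s z * (gauss t (v - z) * p (x + v)))"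
    by (simp add: Gconv_def[of s])
  also have "\<dots> = (LINT v|lborel. LINT z|lborel. gauss s z * (gauss t (v - z) * p (x + v)))"
    using lborel_pair.Fubini_integral[of "\<lambda>v z. gauss s z * (gauss t (v - z) * p (x + v))"]
      lborel_pair.integrable_product_swap[OF int] by (simp add: split_beta')
  also have "\<dots> = (LINT v|lborel. (LINT z|lborel. gauss s z * gauss t (v - z)) * p (x + v))"
    by (simp flip: mult.assoc)
  finally show ?thesis
    by (simp add: gauss_convolution[OF st] Gconv_def[of "s + t"])
qed

section \<open>Positivity of the heat flow between two walls\<close>

lemma Gconv_4th_moment:
  assumes "s > 0"
  shows "integrable lborel (\<lambda>z. gauss s z * z ^ 4)" "(LINT z|lborel. gauss s z * z ^ 4) = 3 * s\<^sup>2"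
proof -
  have "has_bochner_integral lborel (\<lambda>z. gauss s z * (z - 0) ^ (2 * 2)) (fact (2 * 2) / ((2 / (sqrt s)\<^sup>2)^2 * fact 2))"
    using assms by (intro normal_moment_even) auto
  moreover have "fact (2 * 2) / ((2 / (sqrt s)\<^sup>2)^2 * fact 2) = 3 * s\<^sup>2"
    using assms by (simp add: field_simps eval_nat_numeral)
  ultimately have "has_bochner_integral lborel (\<lambda>z. gauss s z * z ^ 4) (3 * s\<^sup>2)"
    by simp
  then show "integrable lborel (\<lambda>z. gauss s z * z ^ 4)" "(LINT z|lborel. gauss s z * z ^ 4) = 3 * s\<^sup>2"
    by (auto simp: has_bochner_integral_iff)
qed

text \<open>Reflection at the nearer of the two walls only; the error comes from paths that
travel a distance 1/2 and is of order \<open>s\<^sup>2\<close> by the fourth moment.\<close>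
lemma Gconv_short_time_lower_bound_left:
  fixes \<psi> :: "real \<Rightarrow> real"
  assumes s: "s > 0" and m[measurable]: "\<psi> \<in> borel_measurable borel" and B: "\<And>x. \<bar>\<psi> x\<bar> \<le> B"
    and odd: "\<And>x. \<psi> (- x) = - \<psi> x"
    and low: "\<And>x. 0 \<le> x \<Longrightarrow> x \<le> 1 \<Longrightarrow> - \<eta> \<le> \<psi> x" and "\<eta> \<ge> 0"
    and x: "0 \<le> x" "x \<le> 1 / 2"
  shows "- \<eta> - 48 * B * s\<^sup>2 \<le> Gconv s \<psi> x"
proof -
  have B0: "B \<ge> 0"
    using B[of 0] by linarith
  have i1: "integrable lborel (\<lambda>y. gauss s (y - x) * \<psi> y)"
    using lborel_integrable_real_affine[OF integrable_Gconv[OF s m B, of x], of 1 "-x"] by (simp add: algebra_simps)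
  have i2: "integrable lborel (\<lambda>y. gauss s (y + x) * \<psi> y)"
    using lborel_integrable_real_affine[OF integrable_Gconv[OF s m B, of "-x"], of 1 x] by (simp add: algebra_simps)
  have e2: "(LINT y|lborel. gauss s (y + x) * \<psi> y) = - Gconv s \<psi> x"
    using Gconv_shift[of s \<psi> "-x"] Gconv_minus[of \<psi> 0 s x] odd by simp
  \<comment> \<open>Oddness gives the value at -x as minus the value at x, and subtracting the two
    convolutions doubles it. For x >= 0 the folded kernel has the sign of y, as does the lower bound
    on \<open>\<psi>\<close>, up to \<open>\<eta>\<close>, on [-1,1].\<close>
  have "(LINT y|lborel. (gauss s (y - x) - gauss s (y + x)) * \<psi> y) = 2 * Gconv s \<psi> x"
    using i1 i2 by (simp add: left_diff_distrib e2 flip: Gconv_shift)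
  moreover
  \<comment> \<open>A pointwise minorant valid for all y: the \<open>\<eta>\<close> terms serve |y|
    <= 1, the fourth powers serve |y| > 1. Each fourth power integrates to \<open>3 * s^2\<close>,
    so each contributes 16 * 3 = 48 times \<open>B * s^2\<close>; there are two of each term, which
    matches the doubling on the other side.\<close>
  let ?b = "\<lambda>y. - (\<eta> * gauss s (y - x) + 16 * B * (gauss s (y - x) * (y - x) ^ 4)
              + (\<eta> * gauss s (y + x) + 16 * B * (gauss s (y + x) * (y + x) ^ 4)))"
  have "?b y \<le> (gauss s (y - x) - gauss s (y + x)) * \<psi> y" for y
  proof -
    let ?g = "gauss s (y - x)" and ?h = "gauss s (y + x)"
    have g: "?g \<ge> 0" "?h \<ge> 0" by auto
    consider "0 \<le> y" "y \<le> 1" | "y \<le> 0" "-1 \<le> y" | "\<bar>y\<bar> > 1" by linarith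
    then show ?thesis
    proof cases
      case 1
      have "?h \<le> ?g"
        using s x 1 by (intro gauss_abs_mono) auto
      then have "(?g - ?h) * - \<eta> \<le> (?g - ?h) * \<psi> y"
        using low[of y] 1 by (intro mult_left_mono) auto
      moreover have "0 \<le> 16 * B * (?g * (y - x) ^ 4) + 16 * B * (?h * (y + x) ^ 4)" "0 \<le> \<eta> * ?h"
        using B0 \<open>\<eta> \<ge> 0\<close> by auto
      ultimately show ?thesis
        by (simp add: algebra_simps)
    next
      case 2
      have "?g \<le> ?h"
        using s x 2 by (intro gauss_abs_mono) auto
      moreover have "- \<eta> \<le> - \<psi> y"
        using low[of "-y"] 2 odd[of y] by auto
      ultimately have "(?h - ?g) * - \<eta> \<le> (?h - ?g) * - \<psi> y"
        by (intro mult_left_mono) auto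
      moreover have "0 \<le> 16 * B * (?g * (y - x) ^ 4) + 16 * B * (?h * (y + x) ^ 4)" "0 \<le> \<eta> * ?g"
        using B0 \<open>\<eta> \<ge> 0\<close> by auto
      ultimately show ?thesis
        by (simp add: algebra_simps)
    next
      case 3
      \<comment> \<open>Here |y| > 1 and 0 <= x <= 1/2, so both y - x and y + x are at least 1/2 in
        absolute value; 16 = 2^4 makes \<open>16 * w ^ 4\<close> at least 1.\<close>
      have *: "B * c \<le> 16 * B * (c * w ^ 4)" if "\<bar>w\<bar> \<ge> 1 / 2" "c \<ge> 0" for c w
      proof -
        have "(1 / 2) ^ 4 \<le> \<bar>w\<bar> ^ 4"
          using that by (intro power_mono) auto
        then have "1 \<le> 16 * w ^ 4"
          by (simp add: power_divide)
        then have "B * c * 1 \<le> B * c * (16 * w ^ 4)"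
          using B0 that by (intro mult_left_mono) auto
        then show ?thesis
          by (simp add: algebra_simps)
      qed
      have "B * ?g \<le> 16 * B * (?g * (y - x) ^ 4)" "B * ?h \<le> 16 * B * (?h * (y + x) ^ 4)"
        using 3 x by (auto intro!: * simp: abs_if split: if_splits)
      moreover have "\<bar>(?g - ?h) * \<psi> y\<bar> \<le> (?g + ?h) * B"
        unfolding abs_mult using B g by (intro mult_mono) (auto simp: abs_le_iff)
      moreover have "0 \<le> \<eta> * ?g" "0 \<le> \<eta> * ?h"
        using \<open>\<eta> \<ge> 0\<close> by auto
      ultimately show ?thesis
        by (simp add: algebra_simps abs_le_iff)
    qed
  qed
  moreover
  have shift: "integrable lborel (\<lambda>y. gauss s (y + c) * (y + c) ^ 4)"
     "(LINT y|lborel. gauss s (y + c) * (y + c) ^ 4) = 3 * s\<^sup>2"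
     "integrable lborel (\<lambda>y. gauss s (y + c))" "(LINT y|lborel. gauss s (y + c)) = 1" for c
    using lborel_integrable_real_affine[OF Gconv_4th_moment(1)[OF s], of 1 c]
      lborel_integral_real_affine[of 1 "\<lambda>y. gauss s y * y ^ 4" c] Gconv_4th_moment(2)[OF s]
      lborel_integrable_real_affine[OF integrable_normal_density, of "sqrt s" 1 0 c]
      lborel_integral_real_affine[of 1 "\<lambda>y. gauss s y" c] s
    by (auto simp: add.commute)
  note sh = shift[of x] shift[of "-x", simplified]
  have ib: "integrable lborel ?b"
    using sh by (intro Bochner_Integration.integrable_minus Bochner_Integration.integrable_add integrable_mult_right) auto
  have "integral\<^sup>L lborel ?b = - (\<eta> + 16 * B * (3 * s\<^sup>2) + (\<eta> + 16 * B * (3 * s\<^sup>2)))"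
    by (subst Bochner_Integration.integral_minus, (subst Bochner_Integration.integral_add,
       (intro Bochner_Integration.integrable_add integrable_mult_right sh)+)+) (simp add: sh)
  ultimately show ?thesis
    using integral_mono[OF ib, of "\<lambda>y. (gauss s (y - x) - gauss s (y + x)) * \<psi> y"] i1 i2
    by (simp add: left_diff_distrib)
qed

text \<open>The map x -> 1 - x exchanges the two walls and turns oddness about 1 into oddness about
  0, so the right half of the interval reduces to the left half.\<close>

lemma Gconv_short_time_lower_bound:
  fixes \<psi> :: "real \<Rightarrow> real"
  assumes s: "s > 0" and m[measurable]: "\<psi> \<in> borel_measurable borel" and B: "\<And>x. \<bar>\<psi> x\<bar> \<le> B"
    and odd: "\<And>x. \<psi> (- x) = - \<psi> x" and odd1: "\<And>x. \<psi> (2 - x) = - \<psi> x"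
    and low: "\<And>x. 0 \<le> x \<Longrightarrow> x \<le> 1 \<Longrightarrow> - \<eta> \<le> \<psi> x" and eta: "\<eta> \<ge> 0"
    and x: "0 \<le> x" "x \<le> 1"
  shows "- \<eta> - 48 * B * s\<^sup>2 \<le> Gconv s \<psi> x"
proof (cases "x \<le> 1 / 2")
  case True
  then show ?thesis
    using Gconv_short_time_lower_bound_left[OF s m B odd low eta] x by auto
next
  case False
  have "- \<eta> - 48 * B * s\<^sup>2 \<le> Gconv s (\<lambda>x. \<psi> (1 - x)) (1 - x)"
  proof (rule Gconv_short_time_lower_bound_left[OF s _ B _ _ eta])
    show "\<psi> (1 - - x) = - \<psi> (1 - x)" for x
      using odd1[of "1 - x"] by simp
  qed (use low x False in auto)
  then show ?thesis
    by (simp add: Gconv_reflect)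
qed

lemma Gconv_nonneg:
  fixes \<psi> :: "real \<Rightarrow> real"
  assumes t: "t > 0" and m: "\<psi> \<in> borel_measurable borel" and B: "\<And>x. \<bar>\<psi> x\<bar> \<le> B"
    and odd: "\<And>x. \<psi> (- x) = - \<psi> x" and odd1: "\<And>x. \<psi> (2 - x) = - \<psi> x"
    and low: "\<And>x. 0 \<le> x \<Longrightarrow> x \<le> 1 \<Longrightarrow> 0 \<le> \<psi> x"
    and x: "0 \<le> x" "x \<le> 1"
  shows "0 \<le> Gconv t \<psi> x"
proof -
  have B0: "B \<ge> 0"
    using B[of 0] by linarith
  \<comment> \<open>The bound is proved for all x in [0,1] at once, because the loss accumulated
    over n steps becomes the \<open>\<eta>\<close> of the next one.\<close>
  have steps: "- real n * (48 * B * s\<^sup>2) \<le> Gconv (real n * s) \<psi> x"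
    if "n > 0" "s > 0" "0 \<le> x" "x \<le> 1" for n s x
    using that
  proof (induction n arbitrary: x)
    case 0
    then show ?case by simp
  next
    case (Suc n)
    \<comment> \<open>The first step is treated apart: \<open>gauss 0\<close> is the zero function
      (division by zero), so \<open>Gconv 0\<close> is not the identity and the semigroup law starts
      only at positive times.\<close>
    show ?case
    proof (cases "n = 0")
      case True
      then show ?thesis
        using Gconv_short_time_lower_bound[OF \<open>s > 0\<close> m B odd odd1 _ order.refl Suc.prems(3,4)] low True by simp
    next
      case False
      have ns: "0 < real n * s"
        using False Suc.prems by simp
      have "- (real n * (48 * B * s\<^sup>2)) - 48 * B * s\<^sup>2 \<le> Gconv s (Gconv (real n * s) \<psi>) x"
      proof (rule Gconv_short_time_lower_bound[OF \<open>s > 0\<close> _ abs_Gconv_le[OF ns m B]])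
        show "Gconv (real n * s) \<psi> (- x) = - Gconv (real n * s) \<psi> x" for x
          using Gconv_minus[of \<psi> 0] odd by simp
        show "Gconv (real n * s) \<psi> (2 - x) = - Gconv (real n * s) \<psi> x" for x
          using Gconv_minus[of \<psi> 2] odd1 by simp
      qed (use Suc False B0 m in \<open>auto simp: less_imp_le\<close>)
      also have "\<dots> = Gconv (real (Suc n) * s) \<psi> x"
        using Gconv_Gconv[OF \<open>s > 0\<close> ns m B] by (simp add: algebra_simps)
      finally show ?thesis
        by (simp add: algebra_simps)
    qed
  qed
  have "- (48 * B * t\<^sup>2) * inverse (real (Suc n)) \<le> Gconv t \<psi> x" for n
    using steps[of "Suc n" "t / real (Suc n)" x] t x
    by (simp add: field_simps power2_eq_square del: of_nat_Suc)
  moreover have "(\<lambda>n. - (48 * B * t\<^sup>2) * inverse (real (Suc n))) \<longlonglongrightarrow> - (48 * B * t\<^sup>2) * 0"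
    by (intro tendsto_mult tendsto_const LIMSEQ_inverse_real_of_nat)
  ultimately show ?thesis
    using LIMSEQ_le_const2 by (metis (no_types, lifting) mult_zero_right)
qed

section \<open>The Neumann kernel\<close>

text \<open>For a unit mass at \<open>y\<close> this is the odd 2-periodic extension of \<open>r \<mapsto> F(r) - (1 - r)\<close>
from (0,1), up to the values at the jumps.\<close>
definition saw :: "real \<Rightarrow> real \<Rightarrow> real" where
  "saw y x = frac ((x - y) / 2) + frac ((x + y) / 2) - 1"

lemma borel_measurable_frac[measurable]: "(frac :: real \<Rightarrow> real) \<in> borel_measurable borel"
  unfolding frac_def[abs_def] by measurable

lemma borel_measurable_saw[measurable]: "(\<lambda>(x, y). saw y x) \<in> borel_measurable (borel \<Otimes>\<^sub>M borel)"
  unfolding saw_def by measurable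

lemma borel_measurable_saw1[measurable]: "saw y \<in> borel_measurable borel"
  unfolding saw_def[abs_def] by measurable

lemma abs_saw_le: "\<bar>saw y x\<bar> \<le> 1"
  using frac_ge_0[of "(x - y) / 2"] frac_lt_1[of "(x - y) / 2"]
    frac_ge_0[of "(x + y) / 2"] frac_lt_1[of "(x + y) / 2"] unfolding saw_def by linarith

lemma saw_periodic: "saw y (x + 2) = saw y x"
proof -
  have "frac (a + 1) = frac a" for a :: real
    by (simp add: frac_def)
  from this[of "(x - y) / 2"] this[of "(x + y) / 2"] show ?thesis
    by (simp add: saw_def add_divide_distrib diff_divide_distrib algebra_simps)
qed

lemma saw_minus:
  assumes "(x - y) / 2 \<notin> \<int>" "(x + y) / 2 \<notin> \<int>"
  shows "saw y (- x) = - saw y x"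
proof -
  have "frac (- ((x - y) / 2)) = 1 - frac ((x - y) / 2)" "frac (- ((x + y) / 2)) = 1 - frac ((x + y) / 2)"
    using assms by (simp_all only: frac_neg if_False)
  then show ?thesis
    by (simp add: saw_def minus_divide_left)
qed

lemma saw_eq:
  assumes "0 \<le> y" "y \<le> 1" "0 < x" "x < 1" "x \<noteq> y"
  shows "saw y x = of_bool (x < y) - (1 - x)"
proof -
  have "\<lfloor>(x + y) / 2\<rfloor> = 0"
    using assms by (simp add: floor_eq_iff)
  moreover have "\<lfloor>(x - y) / 2\<rfloor> = - of_bool (x < y)"
    using assms by (auto simp: floor_eq_iff)
  ultimately show ?thesis
    by (simp add: saw_def frac_def field_simps)
qed

lemma countable_half_odd: "countable {z::real. (z + c) / 2 \<in> \<int>}"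
proof (rule countable_subset)
  show "{z. (z + c) / 2 \<in> \<int>} \<subseteq> (\<lambda>k::int. 2 * real_of_int k - c) ` UNIV"
    by (auto simp: Ints_def field_simps)
qed auto

text \<open>Oddness about 0 and period 2 give oddness about 1, which forces the symmetric
  convolution to vanish there. \<open>Gconv_minus\<close> does not apply, since \<open>saw\<close>
  fails to be odd at its jumps; these are countable, so the identity is used almost
  everywhere.\<close>

lemma Gconv_saw_1:
  assumes "t > 0"
  shows "Gconv t (saw y) 1 = 0"
proof -
  have "Gconv t (saw y) 1 = (LINT z|lborel. gauss t (- z) * saw y (1 + - z))"
    unfolding Gconv_def by (subst lborel_integral_real_affine[where c = "-1" and t = 0]) auto
  also have "\<dots> = (LINT z|lborel. - (gauss t z * saw y (1 + z)))"
  proof (rule integral_cong_AE)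
    have "AE z in lborel. z \<notin> {z. (z + (-1 - y)) / 2 \<in> \<int>} \<union> {z. (z + (y - 1)) / 2 \<in> \<int>}"
      by (intro AE_not_in countable_imp_null_set_lborel countable_Un countable_half_odd)
    then show "AE z in lborel. gauss t (- z) * saw y (1 + - z) = - (gauss t z * saw y (1 + z))"
    proof eventually_elim
      case (elim z)
      have "saw y (1 - z) = - saw y (z - 1)"
        using saw_minus[of "z - 1" y] elim by (simp add: algebra_simps)
      moreover have "saw y (z - 1) = saw y (1 + z)"
        using saw_periodic[of y "z - 1"] by (simp add: add.commute)
      ultimately show ?case
        by (simp add: gauss_minus)
    qed
  qed measurable
  also have "\<dots> = - Gconv t (saw y) 1"
    by (simp add: Gconv_def)
  finally show ?thesis by simp
qed

section \<open>Counting reflected images in a window\<close>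

lemma count_even_between:
  assumes "\<alpha> \<le> \<beta>"
  shows "(\<integral>\<^sup>+k. indicator {\<alpha><..\<beta>} (2 * real_of_int k) \<partial>count_space UNIV) = ennreal (real_of_int (\<lfloor>\<beta> / 2\<rfloor> - \<lfloor>\<alpha> / 2\<rfloor>))"
proof -
  have "(\<integral>\<^sup>+k. indicator {\<alpha><..\<beta>} (2 * real_of_int k) \<partial>count_space UNIV) =
    (\<integral>\<^sup>+k. indicator {\<lfloor>\<alpha> / 2\<rfloor><..\<lfloor>\<beta> / 2\<rfloor>} k \<partial>count_space UNIV)"
    by (intro nn_integral_cong) (auto simp: indicator_def le_floor_iff floor_less_iff)
  also have "\<dots> = of_nat (card {\<lfloor>\<alpha> / 2\<rfloor><..\<lfloor>\<beta> / 2\<rfloor>})"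
    by simp
  also have "\<dots> = ennreal (real_of_int (\<lfloor>\<beta> / 2\<rfloor> - \<lfloor>\<alpha> / 2\<rfloor>))"
    using assms by (simp add: ennreal_of_nat_eq_real_of_nat floor_mono divide_right_mono)
  finally show ?thesis .
qed

text \<open>The first bracket counts the images y + 2k in the window (r + z, 1 + z], the second the
  images 2k - y. This is why the two \<open>frac\<close> terms of \<open>saw\<close> belong to the
  Neumann kernel.\<close>

lemma saw_diff:
  "(1 - r) + saw y (r + z) - saw y (1 + z) =
   real_of_int (\<lfloor>(1 + z - y) / 2\<rfloor> - \<lfloor>(r + z - y) / 2\<rfloor>) + real_of_int (\<lfloor>(1 + z + y) / 2\<rfloor> - \<lfloor>(r + z + y) / 2\<rfloor>)"
  by (simp add: saw_def frac_def field_simps)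

lemma saw_diff_nonneg:
  assumes "r \<le> 1"
  shows "0 \<le> (1 - r) + saw y (r + z) - saw y (1 + z)"
  unfolding saw_diff using assms by (intro add_nonneg_nonneg) (auto intro!: floor_mono divide_right_mono)

text \<open>The term at 1 integrates to zero by \<open>Gconv_saw_1\<close>. Subtracting it costs
  nothing and turns the integrand into the nonnegative image count of
  \<open>saw_diff\<close>.\<close>

lemma Gconv_saw:
  assumes t: "t > 0"
  shows "(LINT z|lborel. gauss t z * ((1 - r) + saw y (r + z) - saw y (1 + z))) = (1 - r) + Gconv t (saw y) r"
proof -
    have i: "integrable lborel (\<lambda>z. gauss t z * saw y (c + z))" for c
      using t abs_saw_le by (intro integrable_Gconv) auto
    have "(LINT z|lborel. gauss t z * (1 - r) + gauss t z * saw y (r + z) - gauss t z * saw y (1 + z)) =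
      (1 - r) + Gconv t (saw y) r - Gconv t (saw y) 1"
      using i[of r] i[of 1] t by (simp add: Gconv_def)
    then show ?thesis
      by (simp add: distrib_left right_diff_distrib Gconv_saw_1[OF t])
qed

lemma Gconv_saw_nonneg:
  assumes "t > 0" "r \<le> 1"
  shows "0 \<le> (1 - r) + Gconv t (saw y) r"
  unfolding Gconv_saw[OF assms(1), symmetric] using saw_diff_nonneg[OF assms(2)]
  by (intro Bochner_Integration.integral_nonneg) auto

lemma Gker_eq: "t > 0 \<Longrightarrow> Gker t x y = gauss t (y - x)"
  by (simp add: Gker_def normal_density_def power2_commute)

section \<open>The image sum as a convergent series and a measurable kernel\<close>

lemma summable_on_Gker:
  assumes "t > 0"
  shows "(\<lambda>k::int. Gker t x (y + 2 * of_int k)) summable_on UNIV"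
proof -
  \<comment> \<open>Completing the square gives
    \<open>(x - y - 2k)^2 >= 2 * k^2 - (y - x)^2\<close>, and k^2 >= |k| for integers. Division by
    2t leaves decay |k| / t in the exponent, hence this geometric ratio.\<close>
  let ?q = "exp (- (1 / t))"
  have q: "0 \<le> ?q" "?q < 1"
    using assms by auto
  have "(\<lambda>n::nat. ?q ^ n) summable_on UNIV"
    using q by (subst summable_on_UNIV_nonneg_real_iff) (auto intro: summable_geometric)
  then have n: "(\<lambda>k::int. ?q ^ nat \<bar>k\<bar>) summable_on range int" "(\<lambda>k::int. ?q ^ nat \<bar>k\<bar>) summable_on range (\<lambda>n. - int n)"
    by (subst summable_on_reindex; simp add: o_def inj_on_def)+
  have "range int \<union> range (\<lambda>n. - int n) = UNIV"
    by (auto simp: image_iff) (metis minus_minus nonneg_int_cases nle_le neg_le_0_iff_le)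
  then have "(\<lambda>k::int. ?q ^ nat \<bar>k\<bar>) summable_on UNIV"
    using summable_on_union[OF n] by simp
  then have s: "(\<lambda>k::int. exp ((y - x)\<^sup>2 / (2 * t)) / sqrt (2 * pi * t) * ?q ^ nat \<bar>k\<bar>) summable_on UNIV"
    by (rule summable_on_cmult_right)
  show ?thesis
  proof (rule summable_on_comparison_test[OF s])
    fix k :: int
    let ?k = "real_of_int k"
    have "exp (- ((x - (y + 2 * ?k))\<^sup>2) / (2 * t)) \<le> exp ((y - x)\<^sup>2 / (2 * t) + (- (1 / t)) * \<bar>?k\<bar>)"
    proof -
      have "\<bar>?k\<bar> \<le> ?k\<^sup>2"
        using mult_left_mono[of 1 "\<bar>?k\<bar>" "\<bar>?k\<bar>"] by (cases "k = 0") (auto simp: power2_eq_square)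
      moreover have "0 \<le> 2 * (x - y - ?k)\<^sup>2"
        by simp
      then have "2 * ?k\<^sup>2 - (y - x)\<^sup>2 \<le> (x - (y + 2 * ?k))\<^sup>2"
        by (simp add: power2_eq_square algebra_simps)
      ultimately have "- ((x - (y + 2 * ?k))\<^sup>2) \<le> (y - x)\<^sup>2 - 2 * \<bar>?k\<bar>"
        by linarith
      then have "- ((x - (y + 2 * ?k))\<^sup>2) / (2 * t) \<le> ((y - x)\<^sup>2 - 2 * \<bar>?k\<bar>) / (2 * t)"
        using assms by (intro divide_right_mono) auto
      then show ?thesis
        using assms by (simp add: diff_divide_distrib)
    qed
    also have "\<dots> = exp ((y - x)\<^sup>2 / (2 * t)) * ?q ^ nat \<bar>k\<bar>"
      unfolding exp_add by (simp add: mult.commute flip: exp_of_nat_mult)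
    finally show "Gker t x (y + 2 * ?k) \<le> exp ((y - x)\<^sup>2 / (2 * t)) / sqrt (2 * pi * t) * ?q ^ nat \<bar>k\<bar>"
      using assms by (simp add: Gker_def divide_right_mono)
  qed (use assms in \<open>auto simp: Gker_def\<close>)
qed

text \<open>\<open>infsum\<close> is 0 on families that are not summable, so summability has to be
  known before it can be read as a sum. As a nonnegative integral over \<open>count_space\<close> it
  can be exchanged with other integrals freely.\<close>

lemma ennreal_Gneum:
  assumes "t > 0"
  shows "ennreal (Gneum t x y) =
    (\<integral>\<^sup>+k. ennreal (Gker t x (y + 2 * of_int k) + Gker t x (2 * of_int k - y)) \<partial>count_space UNIV)"
proof -
  have nn: "Gker t x z \<ge> 0" for z
    using assms by (simp add: Gker_def)
  have "(\<lambda>k::int. Gker t x (y + 2 * of_int k) + Gker t x (2 * of_int k - y)) summable_on UNIV"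
    using summable_on_Gker[OF assms, of x y] summable_on_Gker[OF assms, of x "- y"]
    by (intro summable_on_add) auto
  then have a: "Infinite_Set_Sum.abs_summable_on (\<lambda>k::int. Gker t x (y + 2 * of_int k) + Gker t x (2 * of_int k - y)) UNIV"
    using nn by (subst abs_summable_equivalent[symmetric]) (auto simp: summable_on_iff_abs_summable_on_real[symmetric])
  show ?thesis
    unfolding Gneum_def infsetsum_infsum[OF a, symmetric]
    using nn by (subst nn_integral_conv_infsetsum[OF a]) auto
qed

lemma Gneum_nonneg: "t > 0 \<Longrightarrow> 0 \<le> Gneum t x y"
  unfolding Gneum_def Gker_def by (intro infsum_nonneg) auto

lemma borel_measurable_Gneum[measurable]:
  assumes "t > 0"
  shows "(\<lambda>(x, y). Gneum t x y) \<in> borel_measurable (borel \<Otimes>\<^sub>M borel)"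
proof -
  interpret sigma_finite_measure "count_space (UNIV :: int set)"
    by (intro sigma_finite_measure_count_space_countable) auto
  have "(\<lambda>w. enn2real (\<integral>\<^sup>+k. ennreal (Gker t (fst w) (snd w + 2 * of_int k) + Gker t (fst w) (2 * of_int k - snd w)) \<partial>count_space UNIV))
      \<in> borel_measurable (borel \<Otimes>\<^sub>M borel)"
    unfolding Gker_def by measurable
  then show ?thesis
    by (simp add: split_beta' flip: ennreal_Gneum[OF assms]) (simp add: Gneum_nonneg assms)
qed

lemma borel_measurable_indicator_endpoints[measurable]:
  fixes f g :: "'a \<Rightarrow> real"
  assumes [measurable]: "f \<in> borel_measurable M" "g \<in> borel_measurable M"
  shows "(\<lambda>z. indicator {f z<..g z} b :: ennreal) \<in> borel_measurable M"
proof -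
  have "(\<lambda>z. indicator {f z<..g z} b :: ennreal) = (\<lambda>z. if f z < b \<and> b \<le> g z then 1 else 0)"
    by (auto simp: indicator_def)
  then show ?thesis
    by simp
qed

text \<open>The bridge from the Neumann kernel to the line: the substitution z = image - x centres
  every Gaussian at 0, the sum over images is moved inside, and what remains is the number of images
  in (r + z, 1 + z]. The image sum is not expanded again afterwards.\<close>

lemma nn_integral_Gneum:
  assumes t: "t > 0" and r: "r \<le> 1"
  shows "(\<integral>\<^sup>+x. indicator {r..1} x * ennreal (Gneum t x y) \<partial>lborel) = ennreal ((1 - r) + Gconv t (saw y) r)"
proof -
  let ?C = "count_space (UNIV :: int set)"
  \<comment> \<open>The left endpoint of the interval is dropped, a null set, so that the window is
    half-open and floors count it exactly.\<close>
  have g: "(\<integral>\<^sup>+x. indicator {r..1} x * ennreal (Gker t x (a + 2 * of_int k)) \<partial>lborel) =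
    (\<integral>\<^sup>+z. ennreal (gauss t z) * indicator {r + z - a <.. 1 + z - a} (2 * of_int k) \<partial>lborel)" for a and k :: int
  proof -
    have "(\<integral>\<^sup>+x. indicator {r..1} x * ennreal (Gker t x (a + 2 * of_int k)) \<partial>lborel)
      = (\<integral>\<^sup>+x. indicator {r<..1} x * ennreal (gauss t (a + 2 * of_int k - x)) \<partial>lborel)"
      using AE_lborel_singleton[of r] t
      by (intro nn_integral_cong_AE) (auto simp: Gker_eq indicator_def)
    also have "\<dots> = (\<integral>\<^sup>+z. ennreal (gauss t z) * indicator {r + z - a <.. 1 + z - a} (2 * of_int k) \<partial>lborel)"
      by (subst nn_integral_real_affine[where c = "-1" and t = "a + 2 * of_int k"])
        (auto intro!: nn_integral_cong simp: indicator_def)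
    finally show ?thesis .
  qed
  have "(\<integral>\<^sup>+x. indicator {r..1} x * ennreal (Gneum t x y) \<partial>lborel)
     = (\<integral>\<^sup>+x. \<integral>\<^sup>+k. indicator {r..1} x * ennreal (Gker t x (y + 2 * of_int k) + Gker t x (2 * of_int k - y)) \<partial>?C \<partial>lborel)"
    by (simp add: ennreal_Gneum[OF t] nn_integral_cmult)
  also have "\<dots> = (\<integral>\<^sup>+k. \<integral>\<^sup>+x. indicator {r..1} x * ennreal (Gker t x (y + 2 * of_int k) + Gker t x (2 * of_int k - y)) \<partial>lborel \<partial>?C)"
    by (intro nn_integral_count_space_nn_integral) (auto simp: Gker_def)
  also have "\<dots> = (\<integral>\<^sup>+k. (\<integral>\<^sup>+x. indicator {r..1} x * ennreal (Gker t x (y + 2 * of_int k)) \<partial>lborel)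
      + (\<integral>\<^sup>+x. indicator {r..1} x * ennreal (Gker t x (- y + 2 * of_int k)) \<partial>lborel) \<partial>?C)"
    using t by (subst nn_integral_add[symmetric])
      (auto simp: Gker_def[abs_def] distrib_left[symmetric] ennreal_plus[symmetric] simp del: ennreal_plus intro!: nn_integral_cong)
  also have "\<dots> = (\<integral>\<^sup>+k. \<integral>\<^sup>+z. ennreal (gauss t z) * (indicator {r + z - y <.. 1 + z - y} (2 * of_int k) +
      indicator {r + z + y <.. 1 + z + y} (2 * of_int k)) \<partial>lborel \<partial>?C)"
    unfolding g by (subst nn_integral_add[symmetric]) (auto simp: distrib_left)
  also have "\<dots> = (\<integral>\<^sup>+z. \<integral>\<^sup>+k. ennreal (gauss t z) * (indicator {r + z - y <.. 1 + z - y} (2 * of_int k) +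
      indicator {r + z + y <.. 1 + z + y} (2 * of_int k)) \<partial>?C \<partial>lborel)"
    by (intro nn_integral_count_space_nn_integral[symmetric]) auto
  also have "\<dots> = (\<integral>\<^sup>+z. ennreal (gauss t z * ((1 - r) + saw y (r + z) - saw y (1 + z))) \<partial>lborel)"
  proof (intro nn_integral_cong)
    fix z
    have "(\<integral>\<^sup>+k. ennreal (gauss t z) * (indicator {r + z - y <.. 1 + z - y} (2 * real_of_int k) +
      indicator {r + z + y <.. 1 + z + y} (2 * of_int k)) \<partial>?C)
      = ennreal (gauss t z) * (ennreal (real_of_int (\<lfloor>(1 + z - y) / 2\<rfloor> - \<lfloor>(r + z - y) / 2\<rfloor>)) + ennreal (real_of_int (\<lfloor>(1 + z + y) / 2\<rfloor> - \<lfloor>(r + z + y) / 2\<rfloor>)))"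
      using r by (simp add: nn_integral_cmult nn_integral_add count_even_between)
    also have "\<dots> = ennreal (gauss t z * ((1 - r) + saw y (r + z) - saw y (1 + z)))"
      unfolding saw_diff using r
      by (subst ennreal_plus[symmetric]) (auto simp: ennreal_mult' intro!: floor_mono divide_right_mono)
    finally show "(\<integral>\<^sup>+k. ennreal (gauss t z) * (indicator {r + z - y <.. 1 + z - y} (2 * real_of_int k) +
      indicator {r + z + y <.. 1 + z + y} (2 * of_int k)) \<partial>?C) = ennreal (gauss t z * ((1 - r) + saw y (r + z) - saw y (1 + z)))" .
  qed
  also have "\<dots> = ennreal (LINT z|lborel. gauss t z * ((1 - r) + saw y (r + z) - saw y (1 + z)))"
  proof (rule nn_integral_eq_integral)
    have "\<bar>(1 - r) + saw y (r + z) - saw y (1 + z)\<bar> \<le> \<bar>1 - r\<bar> + 2" for z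
      using abs_saw_le[of y "r + z"] abs_saw_le[of y "1 + z"] by linarith
    then show "integrable lborel (\<lambda>z. gauss t z * ((1 - r) + saw y (r + z) - saw y (1 + z)))"
      by (intro integrable_gauss_bounded[OF t]) auto
  qed (use r saw_diff_nonneg in auto)
  finally show ?thesis
    by (simp add: Gconv_saw[OF t])
qed

section \<open>Heat and cut on profiles\<close>

text \<open>\<open>y\<close> is x reduced modulo 2 to [0,2). The indicators discard all values
  outside (0,1) and put 0 at the integers, so that oddness and periodicity hold at every point and
  not just almost everywhere.\<close>

definition odd_ext :: "(real \<Rightarrow> real) \<Rightarrow> real \<Rightarrow> real" where
  "odd_ext \<phi> x = (let y = 2 * frac (x / 2)
     in indicator {0<..<1} y * \<phi> y - indicator {0<..<1} (2 - y) * \<phi> (2 - y))"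

lemma borel_measurable_odd_ext:
  assumes [measurable]: "(\<lambda>x. indicator {0<..<1} x * \<phi> x) \<in> borel_measurable borel"
  shows "odd_ext \<phi> \<in> borel_measurable borel"
proof -
  have "(\<lambda>x. (\<lambda>x. indicator {0<..<1} x * \<phi> x) (2 * frac (x / 2))) \<in> borel_measurable borel"
    "(\<lambda>x. (\<lambda>x. indicator {0<..<1} x * \<phi> x) (2 - 2 * frac (x / 2))) \<in> borel_measurable borel"
    by (rule measurable_compose[OF _ assms], measurable)+
  then show ?thesis
    unfolding odd_ext_def[abs_def] Let_def by (rule borel_measurable_diff)
qed

lemma abs_odd_ext_le:
  assumes "\<And>x. 0 < x \<Longrightarrow> x < 1 \<Longrightarrow> \<bar>\<phi> x\<bar> \<le> B"
  shows "\<bar>odd_ext \<phi> x\<bar> \<le> B"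
proof -
  have "0 \<le> B"
    using assms[of "1 / 2"] by simp
  then show ?thesis
    using assms[of "2 * frac (x / 2)"] assms[of "2 - 2 * frac (x / 2)"]
    by (auto simp: odd_ext_def Let_def indicator_def)
qed

lemma odd_ext_eq: "0 < x \<Longrightarrow> x < 1 \<Longrightarrow> odd_ext \<phi> x = \<phi> x"
  using frac_eq[of "x / 2"] by (simp add: odd_ext_def Let_def)

lemma odd_ext_periodic: "odd_ext \<phi> (x + 2) = odd_ext \<phi> x"
proof -
  have "frac ((x + 2) / 2) = frac (x / 2)"
    by (simp add: frac_def add_divide_distrib)
  then show ?thesis
    by (simp add: odd_ext_def)
qed

lemma odd_ext_minus: "odd_ext \<phi> (- x) = - odd_ext \<phi> x"
proof (cases "x / 2 \<in> \<int>")
  case True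
  then have "frac (x / 2) = 0" "frac (- (x / 2)) = 0"
    by (simp_all add: frac_eq_0_iff)
  note [simp] = this
  show ?thesis
    by (simp add: odd_ext_def Let_def)
next
  case False
  then have "2 * frac (- x / 2) = 2 - 2 * frac (x / 2)"
    using frac_neg[of "x / 2"] by simp
  then show ?thesis
    by (simp add: odd_ext_def Let_def)
qed

lemma odd_ext_2_minus: "odd_ext \<phi> (2 - x) = - odd_ext \<phi> x"
  using odd_ext_periodic[of \<phi> "- x"] odd_ext_minus[of \<phi> x] by (simp add: add.commute)

lemma odd_ext_cong:
  assumes "\<And>x. 0 < x \<Longrightarrow> x < 1 \<Longrightarrow> \<phi> x = \<psi> x"
  shows "odd_ext \<phi> = odd_ext \<psi>"
  using assms by (auto simp: fun_eq_iff odd_ext_def Let_def indicator_def simp del: frac_gt_0_iff)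

lemma odd_ext_diff: "odd_ext \<phi> x - odd_ext \<psi> x = odd_ext (\<lambda>x. \<phi> x - \<psi> x) x"
  by (simp add: odd_ext_def Let_def algebra_simps)

lemma odd_ext_nonneg:
  assumes "\<And>x. 0 < x \<Longrightarrow> x < 1 \<Longrightarrow> 0 \<le> \<phi> x" "0 \<le> x" "x \<le> 1"
  shows "0 \<le> odd_ext \<phi> x"
proof -
  have "odd_ext \<phi> 0 = 0" "odd_ext \<phi> 1 = 0"
    using odd_ext_minus[of \<phi> 0] odd_ext_2_minus[of \<phi> 1] by simp_all
  then show ?thesis
    using assms odd_ext_eq[of x \<phi>] by (cases "x = 0 \<or> x = 1") auto
qed

text \<open>Identifies superpositions of \<open>saw\<close> and already heated profiles with odd
  extensions by checking (0,1) alone. Integers are excluded because \<open>saw\<close> can jump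
  there; convolution does not see a countable set.\<close>

lemma odd_ext_unique:
  assumes per: "\<And>x. p (x + 2) = p x"
    and odd: "\<And>x. x \<notin> \<int> \<Longrightarrow> p (- x) = - p x"
    and eq: "\<And>x. 0 < x \<Longrightarrow> x < 1 \<Longrightarrow> p x = \<phi> x"
    and x: "x \<notin> \<int>"
  shows "p x = odd_ext \<phi> x"
proof -
  have shift: "q (x + 2 * of_int k) = q x" if "\<And>x. q (x + 2) = q x" for q :: "real \<Rightarrow> real" and x k
  proof (induction k rule: int_induct[of _ 0])
    case (step1 i)
    then show ?case using that[of "x + 2 * of_int i"] by (simp add: algebra_simps)
  next
    case (step2 i)
    then show ?case using that[of "x + 2 * of_int i - 2"] by (simp add: algebra_simps)
  qed simp
  define y where "y = x - 2 * of_int \<lfloor>x / 2\<rfloor>"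
  have y: "0 \<le> y" "y < 2"
    unfolding y_def by linarith+
  have yZ: "y \<notin> \<int>"
    using x unfolding y_def by (metis Ints_add Ints_mult Ints_numeral Ints_of_int diff_add_cancel)
  have "p y = odd_ext \<phi> y"
  proof (cases "y < 1")
    case True
    with yZ y have "0 < y"
      by (cases "y = 0") auto
    with True show ?thesis
      by (simp add: eq odd_ext_eq)
  next
    case False
    with yZ have "1 < y"
      by (cases "y = 1") auto
    then have "p (2 - y) = odd_ext \<phi> (2 - y)"
      using y by (simp add: eq odd_ext_eq)
    moreover have "p (2 - y) = - p y"
      using per[of "- y"] odd[OF yZ] by (simp add: add.commute)
    ultimately show ?thesis
      by (simp add: odd_ext_2_minus)
  qed
  then show ?thesis
    using shift[of p y "\<lfloor>x / 2\<rfloor>"] shift[of "odd_ext \<phi>" y "\<lfloor>x / 2\<rfloor>"] per odd_ext_periodic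
    by (simp add: y_def)
qed

lemma AE_not_Ints: "AE x::real in lborel. x \<notin> \<int>"
  unfolding Ints_def by (intro AE_not_in countable_imp_null_set_lborel) auto

lemma Gconv_cong_AE:
  assumes "AE x in lborel. p x = q x" and [measurable]: "p \<in> borel_measurable borel" "q \<in> borel_measurable borel"
  shows "Gconv t p x = Gconv t q x"
  unfolding Gconv_shift using assms(1) by (intro integral_cong_AE) auto

text \<open>The two barrier steps, acting on the profile \<open>r \<mapsto> F(r)\<close> on (0,1) of a measure of mass \<open>M\<close>.\<close>

definition heat_profile :: "real \<Rightarrow> real \<Rightarrow> (real \<Rightarrow> real) \<Rightarrow> real \<Rightarrow> real" where
  "heat_profile M t f r = M * (1 - r) + Gconv t (odd_ext (\<lambda>x. f x - M * (1 - x))) r"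

definition cut_profile :: "real \<Rightarrow> (real \<Rightarrow> real) \<Rightarrow> real \<Rightarrow> real" where
  "cut_profile a f r = max (f r - a) 0"

text \<open>Only values on the open interval enter, whence the indicator in the measurability
  condition. Nonnegativity is part of the invariant because a cut at level \<open>a\<close> lowers a
  profile by at most \<open>a\<close> only where the profile is nonnegative.\<close>

definition profiles :: "(real \<Rightarrow> real) set" where
  "profiles = {f. (\<lambda>x. indicator {0<..<1} x * f x) \<in> borel_measurable borel \<and>
     (\<exists>B. \<forall>x\<in>{0<..<1}. 0 \<le> f x \<and> f x \<le> B)}"

definition profile_le :: "(real \<Rightarrow> real) \<Rightarrow> (real \<Rightarrow> real) \<Rightarrow> bool" where
  "profile_le f g \<longleftrightarrow> (\<forall>x\<in>{0<..<1}. f x \<le> g x)"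

lemma profile_le_refl: "profile_le f f"
  by (simp add: profile_le_def)

lemma profile_le_trans: "profile_le f g \<Longrightarrow> profile_le g h \<Longrightarrow> profile_le f h"
  unfolding profile_le_def by (meson order_trans)

lemma borel_measurable_profile_diff:
  fixes f g :: "real \<Rightarrow> real"
  assumes "(\<lambda>x. indicator {0<..<1} x * f x) \<in> borel_measurable borel"
    and "(\<lambda>x. indicator {0<..<1} x * g x) \<in> borel_measurable borel"
  shows "(\<lambda>x. indicator {0<..<1} x * (f x - g x)) \<in> borel_measurable borel"
  using borel_measurable_diff[OF assms] by (simp add: right_diff_distrib)

lemma odd_ext_profile:
  assumes "f \<in> profiles" "M \<ge> 0"
  shows "odd_ext (\<lambda>x. f x - M * (1 - x)) \<in> borel_measurable borel"
    and "\<exists>B. \<forall>x. \<bar>odd_ext (\<lambda>x. f x - M * (1 - x)) x\<bar> \<le> B"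
proof -
  obtain B where B: "\<And>x. 0 < x \<Longrightarrow> x < 1 \<Longrightarrow> 0 \<le> f x \<and> f x \<le> B"
    using assms by (fastforce simp: profiles_def)
  have "\<bar>f x - M * (1 - x)\<bar> \<le> B + M" if "0 < x" "x < 1" for x
    using B[OF that] that mult_left_mono[of "1 - x" 1 M] mult_nonneg_nonneg[of M "1 - x"] \<open>M \<ge> 0\<close> by linarith
  then show "\<exists>B. \<forall>x. \<bar>odd_ext (\<lambda>x. f x - M * (1 - x)) x\<bar> \<le> B"
    using abs_odd_ext_le[of "\<lambda>x. f x - M * (1 - x)" "B + M"] by blast
  show "odd_ext (\<lambda>x. f x - M * (1 - x)) \<in> borel_measurable borel"
    using assms by (intro borel_measurable_odd_ext borel_measurable_profile_diff) (auto simp: profiles_def)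
qed

text \<open>At equal mass the linear parts cancel, so the difference of two heated profiles is
  itself a convolved odd extension. Monotonicity and the sup-norm contraction are both read off from
  this.\<close>

lemma heat_profile_diff:
  assumes "f \<in> profiles" "g \<in> profiles" "M \<ge> 0" "t > 0"
  shows "heat_profile M t g r - heat_profile M t f r = Gconv t (odd_ext (\<lambda>x. g x - f x)) r"
proof -
  obtain B B' where B: "\<And>x. \<bar>odd_ext (\<lambda>x. g x - M * (1 - x)) x\<bar> \<le> B"
    "\<And>x. \<bar>odd_ext (\<lambda>x. f x - M * (1 - x)) x\<bar> \<le> B'"
    using odd_ext_profile(2) assms by blast
  have "Gconv t (odd_ext (\<lambda>x. g x - M * (1 - x))) r - Gconv t (odd_ext (\<lambda>x. f x - M * (1 - x))) r
     = Gconv t (odd_ext (\<lambda>x. g x - f x)) r"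
    using assms by (subst Gconv_diff[OF _ _ B(1) _ B(2), symmetric]) (auto simp: odd_ext_diff odd_ext_profile(1))
  then show ?thesis
    by (simp add: heat_profile_def)
qed

lemma profiles_diff:
  assumes "f \<in> profiles" "g \<in> profiles"
  shows "odd_ext (\<lambda>x. g x - f x) \<in> borel_measurable borel" "\<exists>B. \<forall>x. \<bar>odd_ext (\<lambda>x. g x - f x) x\<bar> \<le> B"
proof -
  obtain B B' where B: "\<And>x. 0 < x \<Longrightarrow> x < 1 \<Longrightarrow> 0 \<le> f x \<and> f x \<le> B" "\<And>x. 0 < x \<Longrightarrow> x < 1 \<Longrightarrow> 0 \<le> g x \<and> g x \<le> B'"
    using assms unfolding profiles_def by fastforce
  have "\<bar>g x - f x\<bar> \<le> B + B'" if "0 < x" "x < 1" for x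
    using B[OF that] by (simp add: abs_le_iff)
  then show "\<exists>B. \<forall>x. \<bar>odd_ext (\<lambda>x. g x - f x) x\<bar> \<le> B"
    using abs_odd_ext_le[of "\<lambda>x. g x - f x" "B + B'"] by blast
  show "odd_ext (\<lambda>x. g x - f x) \<in> borel_measurable borel"
    using assms by (intro borel_measurable_odd_ext borel_measurable_profile_diff) (auto simp: profiles_def)
qed

lemma heat_profile_mono:
  assumes "profile_le f g" "f \<in> profiles" "g \<in> profiles" "M \<ge> 0" "t > 0"
  shows "profile_le (heat_profile M t f) (heat_profile M t g)"
proof -
  obtain B where B: "\<And>x. \<bar>odd_ext (\<lambda>x. g x - f x) x\<bar> \<le> B"
    using profiles_diff(2) assms by blast
  have "0 \<le> Gconv t (odd_ext (\<lambda>x. g x - f x)) r" if "0 < r" "r < 1" for r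
    using assms(1) that
    by (intro Gconv_nonneg[OF \<open>t > 0\<close> profiles_diff(1)[OF assms(2,3)] B odd_ext_minus odd_ext_2_minus odd_ext_nonneg])
      (auto simp: profile_le_def)
  then show ?thesis
    using heat_profile_diff[OF assms(2-5)] unfolding profile_le_def
    by (metis diff_ge_0_iff_ge greaterThanLessThan_iff)
qed

text \<open>The zero profile at mass \<open>M\<close> belongs to the measure that has all its mass
  at 0, and the odd extension involved is \<open>M * saw 0\<close> off the integers. The heated
  profile is thus \<open>M\<close> times the integral of the kernel over [r,1].\<close>

lemma heat_profile_zero_nonneg:
  assumes "M \<ge> 0" "t > 0" "r \<le> 1"
  shows "0 \<le> heat_profile M t (\<lambda>_. 0) r"
proof -
  have zero: "(\<lambda>_. 0) \<in> profiles"
    by (auto simp: profiles_def)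
  have "M * saw 0 x = odd_ext (\<lambda>x. 0 - M * (1 - x)) x" if "x \<notin> \<int>" for x
  proof (rule odd_ext_unique[OF _ _ _ that])
    show "M * saw 0 (- x) = - (M * saw 0 x)" if "x \<notin> \<int>" for x
    proof -
      have "x / 2 \<notin> \<int>"
        using that by (metis Ints_mult Ints_numeral nonzero_mult_div_cancel_left times_divide_eq_right zero_neq_numeral)
      then show ?thesis
        by (simp add: saw_minus)
    qed
  qed (simp_all add: saw_periodic saw_eq algebra_simps)
  then have "Gconv t (odd_ext (\<lambda>x. 0 - M * (1 - x))) r = Gconv t (\<lambda>x. M * saw 0 x) r"
    using odd_ext_profile(1)[OF zero \<open>M \<ge> 0\<close>] AE_not_Ints by (intro Gconv_cong_AE) (auto elim: eventually_mono)
  also have "\<dots> = M * Gconv t (saw 0) r"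
    by (simp add: Gconv_def mult.left_commute)
  finally have "heat_profile M t (\<lambda>_. 0) r = M * ((1 - r) + Gconv t (saw 0) r)"
    by (simp add: heat_profile_def distrib_left)
  then show ?thesis
    using assms Gconv_saw_nonneg[of t r 0] by simp
qed

lemma heat_profile_in_profiles:
  assumes "f \<in> profiles" "M \<ge> 0" "t > 0"
  shows "heat_profile M t f \<in> profiles"
proof -
  obtain B where B: "\<And>x. \<bar>odd_ext (\<lambda>x. f x - M * (1 - x)) x\<bar> \<le> B"
    using odd_ext_profile(2) assms by blast
  note m[measurable] = odd_ext_profile(1)[OF assms(1,2)]
  \<comment> \<open>Nonnegativity is inherited by comparison with the zero profile, since the linear
    part prevents reading it off from the convolution directly.\<close>
  have "profile_le (heat_profile M t (\<lambda>_. 0)) (heat_profile M t f)"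
    using assms by (intro heat_profile_mono) (auto simp: profiles_def profile_le_def)
  then have "0 \<le> heat_profile M t f x" if "0 < x" "x < 1" for x
    using that order_trans[OF heat_profile_zero_nonneg[OF assms(2,3), of x]] by (simp add: profile_le_def)
  moreover have "heat_profile M t f x \<le> M + B" if "0 < x" "x < 1" for x
    using that abs_Gconv_le[OF \<open>t > 0\<close> m B, of x] mult_left_mono[of "1 - x" 1 M] \<open>M \<ge> 0\<close>
    by (simp add: heat_profile_def abs_le_iff)
  moreover have "(\<lambda>x. indicator {0<..<1} x * heat_profile M t f x) \<in> borel_measurable borel"
    unfolding heat_profile_def by measurable
  ultimately show ?thesis
    unfolding profiles_def by (auto intro!: exI[of _ "M + B"])
qed

text \<open>Convolution keeps period and oddness, so the convolved extension agrees off the integers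
  with the odd extension of its own restriction to (0,1). Restricting and extending again between
  two heat steps therefore loses nothing, and the semigroup law on the line carries over.\<close>

lemma heat_profile_heat_profile:
  assumes "f \<in> profiles" "M \<ge> 0" "s > 0" "t > 0"
  shows "heat_profile M s (heat_profile M t f) = heat_profile M (s + t) f"
proof
  fix r
  let ?p = "odd_ext (\<lambda>x. f x - M * (1 - x))"
  obtain B where B: "\<And>x. \<bar>?p x\<bar> \<le> B"
    using odd_ext_profile(2) assms by blast
  note m[measurable] = odd_ext_profile(1)[OF assms(1,2)]
  have "Gconv t ?p x = odd_ext (\<lambda>x. heat_profile M t f x - M * (1 - x)) x" if "x \<notin> \<int>" for x
  proof (rule odd_ext_unique[OF _ _ _ that])
    show "Gconv t ?p (- x) = - Gconv t ?p x" for x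
      using Gconv_minus[of ?p 0] odd_ext_minus by simp
  qed (simp_all add: Gconv_periodic odd_ext_periodic heat_profile_def)
  then have "Gconv s (odd_ext (\<lambda>x. heat_profile M t f x - M * (1 - x))) r = Gconv s (Gconv t ?p) r"
    using odd_ext_profile(1)[OF heat_profile_in_profiles] assms AE_not_Ints
    by (intro Gconv_cong_AE) (auto elim: eventually_mono)
  then show "heat_profile M s (heat_profile M t f) r = heat_profile M (s + t) f r"
    using Gconv_Gconv[OF assms(3,4) m B] by (simp add: heat_profile_def[of M s] heat_profile_def[of M "s + t"])
qed

lemma heat_profile_cong:
  assumes "\<And>x. 0 < x \<Longrightarrow> x < 1 \<Longrightarrow> f x = g x"
  shows "heat_profile M t f = heat_profile M t g"
proof -
  have "odd_ext (\<lambda>x. f x - M * (1 - x)) = odd_ext (\<lambda>x. g x - M * (1 - x))"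
    using assms by (intro odd_ext_cong) simp
  then show ?thesis
    by (simp add: heat_profile_def[abs_def])
qed

lemma cut_profile_in_profiles:
  assumes "f \<in> profiles" "a \<ge> 0"
  shows "cut_profile a f \<in> profiles"
proof -
  have [measurable]: "(\<lambda>x. indicator {0<..<1} x * f x) \<in> borel_measurable borel"
    using assms by (simp add: profiles_def)
  have "(\<lambda>x. indicator {0<..<1} x * cut_profile a f x) =
     (\<lambda>x. indicator {0<..<1} x * max (indicator {0<..<1} x * f x - a) 0)"
    by (auto simp: cut_profile_def indicator_def)
  also have "\<dots> \<in> borel_measurable borel"
    by measurable
  finally have m: "(\<lambda>x. indicator {0<..<1} x * cut_profile a f x) \<in> borel_measurable borel" .
  obtain B where "\<forall>x\<in>{0<..<1}. 0 \<le> f x \<and> f x \<le> B"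
    using assms by (auto simp: profiles_def)
  then have "\<forall>x\<in>{0<..<1}. 0 \<le> cut_profile a f x \<and> cut_profile a f x \<le> B"
    using \<open>a \<ge> 0\<close> by (auto simp: cut_profile_def max_def)
  with m show ?thesis
    unfolding profiles_def by blast
qed

lemma cut_profile_mono: "profile_le f g \<Longrightarrow> profile_le (cut_profile a f) (cut_profile a g)"
  by (force simp: profile_le_def cut_profile_def max_def)

lemma cut_profile_cut_profile: "a \<ge> 0 \<Longrightarrow> b \<ge> 0 \<Longrightarrow> cut_profile a (cut_profile b f) = cut_profile (a + b) f"
  by (auto simp: cut_profile_def max_def fun_eq_iff)

text \<open>The contraction bounds the heated profile minus \<open>a\<close> by the right side. The
  truncation at 0 on the left is harmless because the right side, being a profile, is
  nonnegative.\<close>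

lemma cut_heat_le_heat_cut:
  assumes "f \<in> profiles" "M \<ge> 0" "t > 0" "a \<ge> 0"
  shows "profile_le (cut_profile a (heat_profile M t f)) (heat_profile M t (cut_profile a f))"
proof -
  note c = cut_profile_in_profiles[OF assms(1,4)]
  have "\<bar>f x - cut_profile a f x\<bar> \<le> a" if "0 < x" "x < 1" for x
    using assms that by (auto simp: profiles_def cut_profile_def max_def)
  then have "\<bar>odd_ext (\<lambda>x. f x - cut_profile a f x) x\<bar> \<le> a" for x
    by (rule abs_odd_ext_le)
  then have "\<bar>heat_profile M t f r - heat_profile M t (cut_profile a f) r\<bar> \<le> a" for r
    unfolding heat_profile_diff[OF c assms(1-3)]
    by (intro abs_Gconv_le profiles_diff(1) c assms)
  moreover have "0 \<le> heat_profile M t (cut_profile a f) r" if "0 < r" "r < 1" for r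
    using heat_profile_in_profiles[OF c assms(2,3)] that by (auto simp: profiles_def)
  ultimately show ?thesis
    by (auto simp: profile_le_def cut_profile_def abs_le_iff algebra_simps)
qed

section \<open>Refining the time step of both barriers\<close>

definition lower_step :: "real \<Rightarrow> real \<Rightarrow> real \<Rightarrow> (real \<Rightarrow> real) \<Rightarrow> real \<Rightarrow> real" where
  "lower_step M j s f = cut_profile (j * s) (heat_profile M s f)"

definition upper_step :: "real \<Rightarrow> real \<Rightarrow> real \<Rightarrow> (real \<Rightarrow> real) \<Rightarrow> real \<Rightarrow> real" where
  "upper_step M j s f = heat_profile M s (cut_profile (j * s) f)"

context
  fixes M j :: real
  assumes M: "M \<ge> 0" and j: "j > 0"
begin

lemma lower_step_in_profiles: "f \<in> profiles \<Longrightarrow> s > 0 \<Longrightarrow> lower_step M j s f \<in> profiles"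
  using M j by (simp add: lower_step_def cut_profile_in_profiles heat_profile_in_profiles)

lemma upper_step_in_profiles: "f \<in> profiles \<Longrightarrow> s > 0 \<Longrightarrow> upper_step M j s f \<in> profiles"
  using M j by (simp add: upper_step_def cut_profile_in_profiles heat_profile_in_profiles)

lemma lower_step_mono:
  "profile_le f g \<Longrightarrow> f \<in> profiles \<Longrightarrow> g \<in> profiles \<Longrightarrow> s > 0 \<Longrightarrow> profile_le (lower_step M j s f) (lower_step M j s g)"
  using M unfolding lower_step_def by (intro cut_profile_mono heat_profile_mono)

lemma upper_step_mono:
  "profile_le f g \<Longrightarrow> f \<in> profiles \<Longrightarrow> g \<in> profiles \<Longrightarrow> s > 0 \<Longrightarrow> profile_le (upper_step M j s f) (upper_step M j s g)"
  using M j unfolding upper_step_def by (intro cut_profile_mono heat_profile_mono cut_profile_in_profiles) auto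

lemma funpow_in_profiles:
  assumes "\<And>f. f \<in> profiles \<Longrightarrow> \<Phi> f \<in> profiles" "f \<in> profiles"
  shows "(\<Phi> ^^ n) f \<in> profiles"
  using assms by (induction n) auto

text \<open>The outermost \<open>\<Phi>\<close> is replaced by \<open>\<Psi>\<close> at the same
  argument, and then monotonicity of \<open>\<Psi>\<close> passes the induction hypothesis through
  it.\<close>

lemma funpow_profile_le:
  assumes \<Phi>: "\<And>f. f \<in> profiles \<Longrightarrow> \<Phi> f \<in> profiles" and \<Psi>: "\<And>f. f \<in> profiles \<Longrightarrow> \<Psi> f \<in> profiles"
    and le: "\<And>f. f \<in> profiles \<Longrightarrow> profile_le (\<Phi> f) (\<Psi> f)"
    and mono: "\<And>f g. profile_le f g \<Longrightarrow> f \<in> profiles \<Longrightarrow> g \<in> profiles \<Longrightarrow> profile_le (\<Psi> f) (\<Psi> g)"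
    and f: "f \<in> profiles"
  shows "profile_le ((\<Phi> ^^ n) f) ((\<Psi> ^^ n) f)"
proof (induction n)
  case (Suc n)
  note \<Phi>n = funpow_in_profiles[OF \<Phi> f, where n = n] and \<Psi>n = funpow_in_profiles[OF \<Psi> f, where n = n]
  have 1: "profile_le (\<Phi> ((\<Phi> ^^ n) f)) (\<Psi> ((\<Phi> ^^ n) f))"
    by (rule le[OF \<Phi>n])
  have 2: "profile_le (\<Psi> ((\<Phi> ^^ n) f)) (\<Psi> ((\<Psi> ^^ n) f))"
    by (rule mono[OF Suc \<Phi>n \<Psi>n])
  show ?case
    unfolding funpow.simps o_apply by (rule profile_le_trans[OF 1 2])
qed (simp add: profile_le_refl)

lemma funpow_profile_mono:
  assumes "\<And>f. f \<in> profiles \<Longrightarrow> \<Phi> f \<in> profiles"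
    and "\<And>f g. profile_le f g \<Longrightarrow> f \<in> profiles \<Longrightarrow> g \<in> profiles \<Longrightarrow> profile_le (\<Phi> f) (\<Phi> g)"
    and "f \<in> profiles" "g \<in> profiles" "profile_le f g"
  shows "profile_le ((\<Phi> ^^ n) f) ((\<Phi> ^^ n) g)"
  using assms by (induction n) (auto simp: funpow_in_profiles)

text \<open>Refinement raises the lower barrier. Writing C and H with their times, C_s C_ns H_s H_ns
  <= C_s H_s C_ns H_ns: the long cut is moved before the short heat step.\<close>

lemma lower_step_refine:
  assumes "f \<in> profiles" "s > 0" "n > 0"
  shows "profile_le (lower_step M j (real n * s) f) ((lower_step M j s ^^ n) f)"
  using \<open>n > 0\<close>
proof (induction n rule: nat_induct_non_zero)
  case (Suc n)
  let ?H = "heat_profile M" and ?C = cut_profile and ?b = "j * (real n * s)"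
  have p: "real n * s > 0" "?b \<ge> 0" "j * s \<ge> 0"
    using Suc assms j by auto
  have hp: "?H (real n * s) f \<in> profiles"
    using p assms M by (intro heat_profile_in_profiles)
  have eq: "lower_step M j (real (Suc n) * s) f = ?C (j * s) (?C ?b (?H s (?H (real n * s) f)))"
    unfolding lower_step_def cut_profile_cut_profile[OF p(3,2)]
      heat_profile_heat_profile[OF assms(1) M \<open>s > 0\<close> p(1)]
    by (simp add: distrib_left distrib_right)
  have 1: "profile_le (?C (j * s) (?C ?b (?H s (?H (real n * s) f)))) (lower_step M j s (lower_step M j (real n * s) f))"
    unfolding lower_step_def using hp p assms M by (intro cut_profile_mono cut_heat_le_heat_cut) auto
  have 2: "profile_le (lower_step M j s (lower_step M j (real n * s) f)) (lower_step M j s ((lower_step M j s ^^ n) f))"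
    using Suc.IH assms p
      funpow_in_profiles[of "lower_step M j s", OF lower_step_in_profiles[OF _ \<open>s > 0\<close>] \<open>f \<in> profiles\<close>]
    by (intro lower_step_mono) (auto simp: lower_step_in_profiles)
  show ?case
    unfolding eq funpow.simps o_apply by (rule profile_le_trans[OF 1 2])
qed (simp add: profile_le_refl)

text \<open>Refinement lowers the upper barrier: H_s C_s H_ns C_ns <= H_s H_ns C_s C_ns, the short
  cut being moved before the long heat step.\<close>

lemma upper_step_refine:
  assumes "f \<in> profiles" "s > 0" "n > 0"
  shows "profile_le ((upper_step M j s ^^ n) f) (upper_step M j (real n * s) f)"
  using \<open>n > 0\<close>
proof (induction n rule: nat_induct_non_zero)
  case (Suc n)
  let ?H = "heat_profile M" and ?C = cut_profile and ?b = "j * (real n * s)"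
  have p: "real n * s > 0" "?b \<ge> 0" "j * s \<ge> 0"
    using Suc assms j by auto
  have cp: "?C ?b f \<in> profiles"
    using p assms by (intro cut_profile_in_profiles)
  have cp': "?C (j * s + ?b) f \<in> profiles"
    using p assms by (intro cut_profile_in_profiles) auto
  have eq: "upper_step M j (real (Suc n) * s) f = ?H s (?H (real n * s) (?C (j * s) (?C ?b f)))"
    unfolding upper_step_def cut_profile_cut_profile[OF p(3,2)]
      heat_profile_heat_profile[OF cp' M \<open>s > 0\<close> p(1)]
    by (simp add: distrib_left distrib_right)
  have 1: "profile_le (upper_step M j s (upper_step M j (real n * s) f)) (?H s (?H (real n * s) (?C (j * s) (?C ?b f))))"
    unfolding upper_step_def using cp p assms M
    by (intro heat_profile_mono cut_heat_le_heat_cut heat_profile_in_profiles cut_profile_in_profiles) auto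
  have 2: "profile_le (upper_step M j s ((upper_step M j s ^^ n) f)) (upper_step M j s (upper_step M j (real n * s) f))"
    using Suc.IH assms p
      funpow_in_profiles[of "upper_step M j s", OF upper_step_in_profiles[OF _ \<open>s > 0\<close>] \<open>f \<in> profiles\<close>]
    by (intro upper_step_mono) (auto simp: upper_step_in_profiles)
  show ?case
    unfolding eq funpow.simps o_apply by (rule profile_le_trans[OF 2 1])
qed (simp add: profile_le_refl)

lemma lower_steps_le_upper_steps:
  assumes f: "f \<in> profiles" and pos: "\<delta> > 0" "\<delta>' > 0" and eq: "real k * \<delta> = real k' * \<delta>'"
  shows "profile_le ((lower_step M j \<delta> ^^ k) f) ((upper_step M j \<delta>' ^^ k') f)"
proof (cases "k = 0 \<or> k' = 0")
  case True
  then have "k = 0" "k' = 0"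
    using eq pos by auto
  then show ?thesis
    by (simp add: profile_le_refl)
next
  case False
  define \<epsilon> where "\<epsilon> = \<delta> / real k'"
  have e: "\<epsilon> > 0" "\<delta> = real k' * \<epsilon>" "\<delta>' = real k * \<epsilon>"
    using False pos eq by (auto simp: \<epsilon>_def field_simps)
  have 1: "profile_le ((lower_step M j \<delta> ^^ k) f) (((lower_step M j \<epsilon> ^^ k') ^^ k) f)"
    unfolding e(2)
  proof (rule funpow_profile_le[OF _ _ _ _ f])
    fix g assume g: "g \<in> profiles"
    show "lower_step M j (real k' * \<epsilon>) g \<in> profiles"
      using g False e(1) by (simp add: lower_step_in_profiles)
    show "(lower_step M j \<epsilon> ^^ k') g \<in> profiles"
      by (rule funpow_in_profiles[OF lower_step_in_profiles[OF _ e(1)] g])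
    show "profile_le (lower_step M j (real k' * \<epsilon>) g) ((lower_step M j \<epsilon> ^^ k') g)"
      using False by (intro lower_step_refine g e(1)) auto
  next
    show "profile_le ((lower_step M j \<epsilon> ^^ k') g) ((lower_step M j \<epsilon> ^^ k') h)"
      if "g \<in> profiles" "h \<in> profiles" "profile_le g h" for g h
      by (rule funpow_profile_mono[OF lower_step_in_profiles[OF _ e(1)] lower_step_mono[OF _ _ _ e(1)] that])
  qed
  have 2: "profile_le ((lower_step M j \<epsilon> ^^ (k' * k)) f) ((upper_step M j \<epsilon> ^^ (k' * k)) f)"
  proof (rule funpow_profile_le[OF lower_step_in_profiles[OF _ e(1)] upper_step_in_profiles[OF _ e(1)] _ upper_step_mono[OF _ _ _ e(1)] f])
    show "profile_le (lower_step M j \<epsilon> g) (upper_step M j \<epsilon> g)" if "g \<in> profiles" for g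
      unfolding lower_step_def upper_step_def using that e(1) M j by (intro cut_heat_le_heat_cut) auto
  qed
  have 3: "profile_le (((upper_step M j \<epsilon> ^^ k) ^^ k') f) ((upper_step M j \<delta>' ^^ k') f)"
    unfolding e(3)
  proof (rule funpow_profile_le[OF _ _ _ _ f])
    fix g assume g: "g \<in> profiles"
    show "upper_step M j (real k * \<epsilon>) g \<in> profiles"
      using g False e(1) by (simp add: upper_step_in_profiles)
    show "(upper_step M j \<epsilon> ^^ k) g \<in> profiles"
      by (rule funpow_in_profiles[OF upper_step_in_profiles[OF _ e(1)] g])
    show "profile_le ((upper_step M j \<epsilon> ^^ k) g) (upper_step M j (real k * \<epsilon>) g)"
      using False by (intro upper_step_refine g e(1)) auto
  next
    have "real k * \<epsilon> > 0"
      using False e(1) by simp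
    then show "profile_le (upper_step M j (real k * \<epsilon>) g) (upper_step M j (real k * \<epsilon>) h)"
      if "g \<in> profiles" "h \<in> profiles" "profile_le g h" for g h
      using that by (intro upper_step_mono)
  qed
  show ?thesis
    using profile_le_trans[OF profile_le_trans[OF 1[unfolded funpow_mult] 2] 3[unfolded funpow_mult mult.commute[of k k']]] .
qed

end

section \<open>Profiles of the barriers\<close>

text \<open>The invariant carried along both barriers. Since \<open>M\<close> is conserved, the
  single hypothesis \<open>j * \<delta> < M\<close> keeps every later cut inside its domain. The
  density is only asked to be integrable, which is what tail integrals and Fubini arguments
  use.\<close>

definition admissible :: "real \<Rightarrow> umeas \<Rightarrow> bool" where
  "admissible M v \<longleftrightarrow> 0 \<le> fst v \<and> set_integrable lborel {0..1} (snd v) \<and>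
     (\<forall>x\<in>{0..1}. 0 \<le> snd v x) \<and> Fm 0 v = M"

lemma Fm_pos: "0 < r \<Longrightarrow> Fm r v = (LINT x:{r..1}|lborel. snd v x)"
  by (simp add: Fm_def)

lemma Fm_0: "Fm 0 v = fst v + (LINT x:{0..1}|lborel. snd v x)"
  by (simp add: Fm_def)

lemma Fm_1: "Fm 1 v = 0"
proof -
  have "(LINT x:{1..1}|lborel. snd v x) = (LINT x|lborel. indicator {1::real} x *\<^sub>R snd v 1)"
    unfolding set_lebesgue_integral_def
    by (intro Bochner_Integration.integral_cong) (auto simp: indicator_def)
  then show ?thesis
    by (simp add: Fm_pos)
qed

lemma continuous_on_tail:
  fixes f :: "real \<Rightarrow> real"
  assumes "set_integrable lborel {0..1} f"
  shows "continuous_on {0..1} (\<lambda>r. LINT x:{r..1}|lborel. f x)"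
proof -
  have "integral {r..1} f = (LINT x:{r..1}|lborel. f x)" if "r \<in> {0..1}" for r
    using that by (intro set_borel_integral_eq_integral(2)[symmetric] set_integrable_subset[OF assms]) auto
  moreover have "continuous_on {0..1} (\<lambda>r. integral {r..1} f)"
    by (intro indefinite_integral_continuous_1' set_borel_integral_eq_integral assms)
  ultimately show ?thesis
    by (subst (asm) continuous_on_cong) auto
qed

lemma tail_antimono:
  fixes f :: "real \<Rightarrow> real"
  assumes "set_integrable lborel {0..1} f" "\<And>x. x \<in> {0..1} \<Longrightarrow> 0 \<le> f x" "0 \<le> r" "r \<le> s"
  shows "(LINT x:{s..1}|lborel. f x) \<le> (LINT x:{r..1}|lborel. f x)"
  unfolding set_lebesgue_integral_def
proof (rule integral_mono)
  show "integrable lborel (\<lambda>x. indicator {s..1} x *\<^sub>R f x)" "integrable lborel (\<lambda>x. indicator {r..1} x *\<^sub>R f x)"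
    using set_integrable_subset[OF assms(1), of "{s..1}"] set_integrable_subset[OF assms(1), of "{r..1}"] assms(3,4)
    by (auto simp: set_integrable_def)
qed (use assms in \<open>auto simp: indicator_def\<close>)

lemma tail_nonneg:
  fixes f :: "real \<Rightarrow> real"
  assumes "\<And>x. x \<in> {0..1} \<Longrightarrow> 0 \<le> f x" "0 \<le> r"
  shows "0 \<le> (LINT x:{r..1}|lborel. f x)"
  unfolding set_lebesgue_integral_def using assms
  by (intro Bochner_Integration.integral_nonneg) (auto simp: indicator_def)

lemma admissible_mass_nonneg: "admissible M v \<Longrightarrow> 0 \<le> M"
  using tail_nonneg[of "snd v" 0] by (auto simp: admissible_def Fm_0)

lemma admissible_profile:
  assumes "admissible M v"
  shows "(\<lambda>r. Fm r v) \<in> profiles"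
proof -
  have v: "set_integrable lborel {0..1} (snd v)" "\<And>x. x \<in> {0..1} \<Longrightarrow> 0 \<le> snd v x"
    using assms by (auto simp: admissible_def)
  let ?T = "\<lambda>r. LINT x:{r..1}|lborel. snd v x"
  have "continuous_on {0<..<1} ?T"
    by (rule continuous_on_subset[OF continuous_on_tail[OF v(1)]]) auto
  then have "(\<lambda>r. indicator {0<..<1} r *\<^sub>R ?T r) \<in> borel_measurable borel"
    by (intro borel_measurable_continuous_on_indicator) auto
  moreover have "(\<lambda>r. indicator {0<..<1} r *\<^sub>R ?T r) = (\<lambda>r. indicator {0<..<1} r * Fm r v)"
    by (auto simp: Fm_pos indicator_def)
  moreover have "\<forall>r\<in>{0<..<1}. 0 \<le> Fm r v \<and> Fm r v \<le> ?T 0"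
    using v by (auto simp: Fm_pos intro!: tail_nonneg tail_antimono)
  ultimately show ?thesis
    unfolding profiles_def by auto
qed

text \<open>Without an atom the tail mass is continuous on all of [0,1], including 0. The level
  \<open>a\<close> is then reached by the intermediate value theorem, and the infimum is attained
  because the level set is closed.\<close>

lemma Rcut_props:
  assumes "admissible M v" "fst v = 0" "0 < a" "a < M" "a = j * \<delta>"
  defines "R \<equiv> Rcut j \<delta> v"
  shows "0 \<le> R" "R \<le> 1" "Fm R v = a"
proof -
  let ?S = "{r \<in> {0..1}. Fm r v = a}" and ?T = "\<lambda>r. LINT x:{r..1}|lborel. snd v x"
  have F: "Fm r v = ?T r" for r
    using assms(2) by (simp add: Fm_def)
  have c: "continuous_on {0..1} (\<lambda>r. Fm r v)"
    unfolding F using assms(1) by (intro continuous_on_tail) (auto simp: admissible_def)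
  have "Fm 1 v \<le> a" "a \<le> Fm 0 v"
    using assms(1,3,4) Fm_1[of v] by (simp_all add: admissible_def)
  then obtain r where "0 \<le> r" "r \<le> 1" "Fm r v = a"
    using IVT2'[of "\<lambda>r. Fm r v" 1 a 0, OF _ _ _ c] by auto
  then have ne: "?S \<noteq> {}"
    by auto
  have "?S = {0..1} \<inter> (\<lambda>r. Fm r v) -` {a}"
    by auto
  then have "closed ?S"
    using continuous_closed_preimage[OF c, of "{a}"] by simp
  then have "Inf ?S \<in> ?S"
    using ne by (intro closed_contains_Inf) (auto intro!: bdd_belowI[of _ 0])
  moreover have "R = Inf ?S"
    unfolding R_def Rcut_def assms(5) ..
  ultimately have "R \<in> ?S"
    by simp
  then show "0 \<le> R" "R \<le> 1" "Fm R v = a"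
    by auto
qed

lemma tail_split:
  fixes f :: "real \<Rightarrow> real"
  assumes "set_integrable lborel {0..1} f" "0 \<le> r" "r \<le> R" "R \<le> 1"
  shows "(LINT x:{r..1}|lborel. indicator {0..R} x * f x) = (LINT x:{r..1}|lborel. f x) - (LINT x:{R..1}|lborel. f x)"
proof -
  have i: "integrable lborel (\<lambda>x. indicator {r..1} x *\<^sub>R f x)" "integrable lborel (\<lambda>x. indicator {R..1} x *\<^sub>R f x)"
    using set_integrable_subset[OF assms(1), of "{r..1}"] set_integrable_subset[OF assms(1), of "{R..1}"] assms(2-4)
    by (auto simp: set_integrable_def)
  have m: "(\<lambda>x. indicator {0..1} x *\<^sub>R f x) \<in> borel_measurable lborel"
    using assms(1) by (auto simp: set_integrable_def)
  have "(\<lambda>x. indicator {r..R} x * (indicator {0..1} x *\<^sub>R f x)) \<in> borel_measurable lborel"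
    using m by (intro borel_measurable_times) auto
  also have "(\<lambda>x. indicator {r..R} x * (indicator {0..1} x *\<^sub>R f x)) = (\<lambda>x. indicator {r..1} x *\<^sub>R (indicator {0..R} x * f x))"
    using assms(2-4) by (auto simp: indicator_def)
  finally have m': "(\<lambda>x. indicator {r..1} x *\<^sub>R (indicator {0..R} x * f x)) \<in> borel_measurable lborel" .
  have "(LINT x:{r..1}|lborel. indicator {0..R} x * f x) =
    (LINT x|lborel. indicator {r..1} x *\<^sub>R f x - indicator {R..1} x *\<^sub>R f x)"
    unfolding set_lebesgue_integral_def
  proof (rule integral_cong_AE)
    show "AE x in lborel. indicator {r..1} x *\<^sub>R (indicator {0..R} x * f x) = indicator {r..1} x *\<^sub>R f x - indicator {R..1} x *\<^sub>R f x"
      using AE_lborel_singleton[of R] by eventually_elim (use assms(2-4) in \<open>auto simp: indicator_def\<close>)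
  qed (use m' i in \<open>simp_all add: borel_measurable_integrable\<close>)
  then show ?thesis
    using i by (simp add: set_lebesgue_integral_def)
qed

text \<open>The removed mass \<open>a\<close> reappears as an atom at 0, so the total mass is
  unchanged while every tail from r > 0 is lowered. This is why the formula is restricted to
  positive r.\<close>

lemma Kcut_profile:
  assumes v: "admissible M v" "fst v = 0" and a: "0 < a" "a < M" "a = j * \<delta>"
  shows "admissible M (Kcut j \<delta> v)"
    and "\<And>r. 0 < r \<Longrightarrow> Fm r (Kcut j \<delta> v) = cut_profile a (\<lambda>r. Fm r v) r"
proof -
  define R where "R = Rcut j \<delta> v"
  note R = Rcut_props[OF v a, folded R_def]
  have i: "set_integrable lborel {0..1} (snd v)" and nn: "\<And>x. x \<in> {0..1} \<Longrightarrow> 0 \<le> snd v x"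
    using v by (auto simp: admissible_def)
  have F: "Fm r v = (LINT x:{r..1}|lborel. snd v x)" for r
    using v(2) by (simp add: Fm_def)
  have K: "Kcut j \<delta> v = (a, \<lambda>r. indicator {0..R} r * snd v r)"
    using v(2) a(3) by (simp add: Kcut_def R_def)
  have "set_integrable lborel {0..R} (snd v)"
    using R by (intro set_integrable_subset[OF i]) auto
  then have iR: "integrable lborel (\<lambda>x. indicator {0..R} x *\<^sub>R snd v x)"
    by (simp add: set_integrable_def)
  have eq: "(\<lambda>x. indicator {0..R} x *\<^sub>R snd v x) = (\<lambda>x. indicator {0..1} x *\<^sub>R (indicator {0..R} x * snd v x))"
    using R by (auto simp: indicator_def)
  have "set_integrable lborel {0..1} (\<lambda>r. indicator {0..R} r * snd v r)"
    using iR unfolding set_integrable_def eq .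
  moreover have "Fm 0 (Kcut j \<delta> v) = M"
    unfolding K Fm_0 using tail_split[OF i, of 0 R] R v by (simp add: F[symmetric] admissible_def)
  ultimately show "admissible M (Kcut j \<delta> v)"
    using a nn by (auto simp: admissible_def K indicator_def)
  fix r :: real
  assume r: "0 < r"
  show "Fm r (Kcut j \<delta> v) = cut_profile a (\<lambda>r. Fm r v) r"
  proof (cases "r \<le> R")
    case True
    have "a \<le> Fm r v"
      using tail_antimono[OF i nn, of r R] True r R(3) by (simp add: F)
    then show ?thesis
      unfolding K Fm_pos[OF r] cut_profile_def using tail_split[OF i, of r R] True r R by (simp add: F[symmetric])
  next
    case False
    have "Fm r v \<le> a"
      using tail_antimono[OF i nn, of R r] False R by (simp add: F)
    moreover have "Fm r (Kcut j \<delta> v) = (LINT x|(lborel :: real measure). 0)"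
      unfolding Fm_pos[OF r] K set_lebesgue_integral_def using False
      by (intro Bochner_Integration.integral_cong) (auto simp: indicator_def)
    ultimately show ?thesis
      by (simp add: cut_profile_def)
  qed
qed

section \<open>Heat on measures agrees with heat on profiles\<close>

lemma Gconv_superposition:
  fixes w :: "real \<Rightarrow> real"
  assumes t: "t > 0" and w: "integrable lborel w"
  shows "(LINT y|lborel. w y * Gconv t (saw y) r) = Gconv t (\<lambda>x. LINT y|lborel. w y * saw y x) r"
proof -
  have [measurable]: "w \<in> borel_measurable borel"
    using w by auto
  let ?h = "\<lambda>(y, z). w y * (gauss t z * saw y (r + z))"
  have "integrable (lborel \<Otimes>\<^sub>M lborel) ?h"
  proof (rule Bochner_Integration.integrable_bound)
    show "integrable (lborel \<Otimes>\<^sub>M lborel) (\<lambda>(y, z). w y * gauss t z)"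
      using w t by (intro lborel_pair.Fubini_integrable) (auto simp: abs_mult)
    show "?h \<in> borel_measurable (lborel \<Otimes>\<^sub>M lborel)"
      by measurable
    show "AE x in lborel \<Otimes>\<^sub>M lborel. norm (?h x) \<le> norm (case x of (y, z) \<Rightarrow> w y * gauss t z)"
      using abs_saw_le by (auto simp: abs_mult intro!: AE_I2 mult_left_mono mult_left_le)
  qed
  then have "(LINT y|lborel. LINT z|lborel. w y * (gauss t z * saw y (r + z))) =
      (LINT z|lborel. LINT y|lborel. w y * (gauss t z * saw y (r + z)))"
    by (intro lborel_pair.Fubini_integral[symmetric])
  moreover have "(LINT y|lborel. w y * (gauss t z * saw y (r + z))) = gauss t z * (LINT y|lborel. w y * saw y (r + z))" for z
    by (subst integral_mult_right_zero[symmetric]) (simp add: mult.left_commute)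
  ultimately show ?thesis
    by (simp add: Gconv_def)
qed

text \<open>Each unit mass at y contributes \<open>saw y\<close>, which on (0,1) is its own profile
  minus 1 - x. The weights add up to \<open>M\<close>, so the linear parts add up to
  \<open>M * (1 - x)\<close>.\<close>

lemma Fm_eq_superposition:
  assumes v: "admissible M v"
  defines "w \<equiv> \<lambda>y. indicator {0..1} y * snd v y"
  assumes x: "x \<notin> \<int>"
  shows "fst v * saw 0 x + (LINT y|lborel. w y * saw y x) = odd_ext (\<lambda>r. Fm r v - M * (1 - r)) x"
proof (rule odd_ext_unique[OF _ _ _ x])
  have i: "integrable lborel w"
    using v by (simp add: admissible_def set_integrable_def w_def)
  have [measurable]: "w \<in> borel_measurable borel"
    using i by auto
  have M: "M = fst v + (LINT y|lborel. w y)"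
    using v by (simp add: admissible_def Fm_0 set_lebesgue_integral_def w_def)
  fix x :: real
  show "fst v * saw 0 (x + 2) + (LINT y|lborel. w y * saw y (x + 2)) =
        fst v * saw 0 x + (LINT y|lborel. w y * saw y x)"
    by (simp add: saw_periodic)
  show "fst v * saw 0 (- x) + (LINT y|lborel. w y * saw y (- x)) =
        - (fst v * saw 0 x + (LINT y|lborel. w y * saw y x))" if "x \<notin> \<int>"
  proof -
    have "x / 2 \<notin> \<int>"
      using that by (metis Ints_mult Ints_numeral nonzero_mult_div_cancel_left times_divide_eq_right zero_neq_numeral)
    then have "saw 0 (- x) = - saw 0 x"
      by (simp add: saw_minus)
    moreover have "(LINT y|lborel. w y * saw y (- x)) = (LINT y|lborel. - (w y * saw y x))"
    proof (rule integral_cong_AE)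
      have "AE y in lborel. y \<notin> {y. (y + x) / 2 \<in> \<int>} \<union> {y. (y + (- x)) / 2 \<in> \<int>}"
        by (intro AE_not_in countable_imp_null_set_lborel countable_Un countable_half_odd)
      then show "AE y in lborel. w y * saw y (- x) = - (w y * saw y x)"
      proof eventually_elim
        case (elim y)
        have "(x - y) / 2 = - ((y + (- x)) / 2)"
          by (simp add: field_simps)
        then have "(x - y) / 2 \<notin> \<int>"
          using elim by (metis (mono_tags) Ints_minus UnI2 mem_Collect_eq minus_minus)
        then show ?case
          using elim saw_minus[of x y] by (simp add: add.commute)
      qed
    qed measurable
    ultimately show ?thesis
      by simp
  qed
  show "fst v * saw 0 x + (LINT y|lborel. w y * saw y x) = Fm x v - M * (1 - x)" if "0 < x" "x < 1"
  proof -
    have ix: "integrable lborel (\<lambda>y. indicator {x..1} y * w y)"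
      using integrable_real_mult_indicator[OF _ i, of "{x..1}"] by (simp add: mult.commute)
    have "(LINT y|lborel. w y * saw y x) = (LINT y|lborel. indicator {x..1} y * w y - w y * (1 - x))"
    proof (rule integral_cong_AE)
      show "AE y in lborel. w y * saw y x = indicator {x..1} y * w y - w y * (1 - x)"
        using AE_lborel_singleton[of x]
      proof eventually_elim
        case (elim y)
        show ?case
        proof (cases "y \<in> {0..1}")
          case True
          then have eq: "saw y x = of_bool (x < y) - (1 - x)"
            using elim that by (intro saw_eq) auto
          show ?thesis
            unfolding eq using True elim by (auto simp: w_def indicator_def algebra_simps)
        qed (simp add: w_def)
      qed
    qed measurable
    also have "\<dots> = (LINT y|lborel. indicator {x..1} y * w y) - (LINT y|lborel. w y) * (1 - x)"
      using i ix by simp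
    also have "(LINT y|lborel. indicator {x..1} y * w y) = Fm x v"
      unfolding Fm_pos[OF that(1)] set_lebesgue_integral_def
      using that by (intro Bochner_Integration.integral_cong) (auto simp: w_def indicator_def)
    finally show ?thesis
      using that by (simp add: M saw_eq algebra_simps)
  qed
qed

text \<open>By Tonelli the kernel is integrated over [r,1] first, where
  \<open>nn_integral_Gneum\<close> applies, and the initial mass second. Including r = 0 yields
  conservation of mass later.\<close>

lemma heat_profile_eq:
  assumes v: "admissible M v" and t: "t > 0" and r: "0 \<le> r" "r \<le> 1"
  shows "set_integrable lborel {r..1} (snd (heat t v))"
    and "(LINT x:{r..1}|lborel. snd (heat t v) x) = heat_profile M t (\<lambda>r. Fm r v) r"
proof -
  note [measurable] = borel_measurable_Gneum[OF t]
  define w where "w = (\<lambda>y. indicator {0..1} y * snd v y)"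
  define P where "P = (\<lambda>r y. (1 - r) + Gconv t (saw y) r)"
  define c where "c = fst v"
  have c: "c \<ge> 0" and w0: "\<And>y. 0 \<le> w y"
    using v by (auto simp: admissible_def w_def c_def indicator_def)
  have i: "integrable lborel w"
    using v by (simp add: admissible_def set_integrable_def w_def)
  have [measurable]: "w \<in> borel_measurable borel"
    using i by auto
  have P0: "0 \<le> P r y" for y
    using Gconv_saw_nonneg[OF t r(2)] by (simp add: P_def)
  have [measurable]: "P r \<in> borel_measurable borel"
    unfolding P_def Gconv_def by measurable
  have G: "\<bar>Gconv t (saw y) r\<bar> \<le> 1" for y
    using abs_saw_le by (intro abs_Gconv_le t) auto
  have iG: "integrable lborel (\<lambda>y. w y * Gconv t (saw y) r)"
  proof (rule Bochner_Integration.integrable_bound[OF i])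
    show "(\<lambda>y. w y * Gconv t (saw y) r) \<in> borel_measurable lborel"
      unfolding Gconv_def by measurable
  qed (use G in \<open>auto simp: abs_mult intro!: AE_I2 mult_left_le\<close>)
  then have iP: "integrable lborel (\<lambda>y. w y * P r y)"
    using i by (simp add: P_def distrib_left)
  define I where "I = (\<lambda>x. \<integral>\<^sup>+y. ennreal (w y * Gneum t x y) \<partial>lborel)"
  have [measurable]: "I \<in> borel_measurable borel"
    unfolding I_def by measurable
  define val where "val = c * P r 0 + (LINT y|lborel. w y * P r y)"
  have val0: "0 \<le> val"
    unfolding val_def using c w0 P0 by (intro add_nonneg_nonneg Bochner_Integration.integral_nonneg) auto
  have tot: "(\<integral>\<^sup>+x. indicator {r..1} x * (ennreal (c * Gneum t x 0) + I x) \<partial>lborel) = ennreal val"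
  proof -
    have "(\<integral>\<^sup>+x. indicator {r..1} x * I x \<partial>lborel) =
       (\<integral>\<^sup>+x. \<integral>\<^sup>+y. ennreal (w y) * (indicator {r..1} x * ennreal (Gneum t x y)) \<partial>lborel \<partial>lborel)"
      unfolding I_def using w0 t
      by (subst nn_integral_cmult[symmetric]) (auto simp: ennreal_mult' mult_ac intro!: nn_integral_cong)
    also have "\<dots> = (\<integral>\<^sup>+y. \<integral>\<^sup>+x. ennreal (w y) * (indicator {r..1} x * ennreal (Gneum t x y)) \<partial>lborel \<partial>lborel)"
      by (intro lborel_pair.Fubini') measurable
    also have "\<dots> = (\<integral>\<^sup>+y. ennreal (w y * P r y) \<partial>lborel)"
      using w0 by (simp add: nn_integral_cmult nn_integral_Gneum[OF t r(2)] P_def ennreal_mult')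
    also have "\<dots> = ennreal (LINT y|lborel. w y * P r y)"
      using w0 P0 iP by (intro nn_integral_eq_integral) auto
    finally have 1: "(\<integral>\<^sup>+x. indicator {r..1} x * I x \<partial>lborel) = ennreal (LINT y|lborel. w y * P r y)" .
    have "(\<integral>\<^sup>+x. indicator {r..1} x * ennreal (c * Gneum t x 0) \<partial>lborel) =
        (\<integral>\<^sup>+x. ennreal c * (indicator {r..1} x * ennreal (Gneum t x 0)) \<partial>lborel)"
      using c by (auto simp: ennreal_mult' mult_ac intro!: nn_integral_cong)
    also have "\<dots> = ennreal (c * P r 0)"
      using c by (simp add: nn_integral_cmult nn_integral_Gneum[OF t r(2)] P_def ennreal_mult')
    finally show ?thesis
      using 1 c P0 w0 unfolding val_def
      by (simp add: distrib_left nn_integral_add ennreal_plus Bochner_Integration.integral_nonneg)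
  qed
  have h: "snd (heat t v) x = c * Gneum t x 0 + (LINT y|lborel. w y * Gneum t x y)" for x
    by (simp add: heat_def c_def w_def set_lebesgue_integral_def mult_ac)
  have [measurable]: "snd (heat t v) \<in> borel_measurable borel"
    unfolding h by measurable
  have h0: "0 \<le> snd (heat t v) x" for x
    unfolding h using c w0 Gneum_nonneg[OF t]
    by (intro add_nonneg_nonneg Bochner_Integration.integral_nonneg) auto
  \<comment> \<open>The density of \<open>heat\<close> is a Bochner integral over y, with value 0
    where that integral diverges. Finiteness of the total shows that this can happen only on a null
    subset of [r,1].\<close>
  have "AE x in lborel. indicator {r..1} x * (ennreal (c * Gneum t x 0) + I x) \<noteq> \<infinity>"
    using tot by (intro nn_integral_noteq_infinite) auto
  then have "AE x in lborel. ennreal (indicator {r..1} x *\<^sub>R snd (heat t v) x) =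
      indicator {r..1} x * (ennreal (c * Gneum t x 0) + I x)"
  proof eventually_elim
    case (elim x)
    show ?case
    proof (cases "x \<in> {r..1}")
      case True
      then have "I x \<noteq> \<infinity>"
        using elim by auto
      moreover have "(LINT y|lborel. w y * Gneum t x y) = enn2real (I x)"
        unfolding I_def using w0 Gneum_nonneg[OF t] by (intro integral_eq_nn_integral) auto
      ultimately have "ennreal (LINT y|lborel. w y * Gneum t x y) = I x"
        by (simp add: top.not_eq_extremum)
      then show ?thesis
        using True c w0 Gneum_nonneg[OF t]
        by (simp add: h ennreal_plus Bochner_Integration.integral_nonneg)
    qed simp
  qed
  then have "(\<integral>\<^sup>+x. ennreal (indicator {r..1} x *\<^sub>R snd (heat t v) x) \<partial>lborel) = ennreal val"
    unfolding tot[symmetric] by (rule nn_integral_cong_AE)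
  then have hv: "integrable lborel (\<lambda>x. indicator {r..1} x *\<^sub>R snd (heat t v) x) \<and>
      (LINT x|lborel. indicator {r..1} x *\<^sub>R snd (heat t v) x) = val"
    using val0 h0 by (subst (asm) nn_integral_eq_integrable) auto
  then show "set_integrable lborel {r..1} (snd (heat t v))"
    by (simp add: set_integrable_def)
  let ?p = "\<lambda>x. c * saw 0 x + (LINT y|lborel. w y * saw y x)"
  have "Gconv t ?p r = Gconv t (odd_ext (\<lambda>x. Fm x v - M * (1 - x))) r"
  proof (rule Gconv_cong_AE)
    show "AE x in lborel. ?p x = odd_ext (\<lambda>x. Fm x v - M * (1 - x)) x"
      using AE_not_Ints by eventually_elim (simp add: Fm_eq_superposition[OF v] w_def c_def)
    show "odd_ext (\<lambda>x. Fm x v - M * (1 - x)) \<in> borel_measurable borel"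
      using odd_ext_profile(1)[OF admissible_profile[OF v] admissible_mass_nonneg[OF v]] .
  qed measurable
  moreover have "Gconv t ?p r = c * Gconv t (saw 0) r + (LINT y|lborel. w y * Gconv t (saw y) r)"
  proof -
    have "\<bar>LINT y|lborel. w y * saw y x\<bar> \<le> (LINT y|lborel. w y)" for x
    proof (rule integral_abs_bound_integral[OF _ i])
      show "integrable lborel (\<lambda>y. w y * saw y x)"
        by (rule Bochner_Integration.integrable_bound[OF i])
          (use abs_saw_le in \<open>auto simp: abs_mult intro!: AE_I2 mult_left_le\<close>)
    qed (use w0 abs_saw_le in \<open>auto simp: abs_mult intro!: mult_left_le\<close>)
    then have "integrable lborel (\<lambda>z. gauss t z * (LINT y|lborel. w y * saw y (r + z)))"
      by (intro integrable_Gconv[OF t]) measurable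
    moreover have "integrable lborel (\<lambda>z. gauss t z * saw 0 (r + z))"
      using abs_saw_le by (intro integrable_Gconv[OF t]) auto
    ultimately show ?thesis
      by (simp add: Gconv_superposition[OF t i]) (simp add: Gconv_def distrib_left mult.left_commute)
  qed
  moreover have "M = c + (LINT y|lborel. w y)"
    using v by (simp add: admissible_def Fm_0 set_lebesgue_integral_def w_def c_def)
  moreover have "val = c * P r 0 + ((LINT y|lborel. w y) * (1 - r) + (LINT y|lborel. w y * Gconv t (saw y) r))"
    using i iG by (simp add: val_def P_def distrib_left)
  ultimately show "(LINT x:{r..1}|lborel. snd (heat t v) x) = heat_profile M t (\<lambda>r. Fm r v) r"
    using hv by (simp add: set_lebesgue_integral_def heat_profile_def P_def algebra_simps)
qed

lemma heat_admissible:
  assumes v: "admissible M v" and t: "t > 0"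
  shows "admissible M (heat t v)" "fst (heat t v) = 0"
    and "\<And>r. 0 < r \<Longrightarrow> r < 1 \<Longrightarrow> Fm r (heat t v) = heat_profile M t (\<lambda>r. Fm r v) r"
proof -
  show f: "fst (heat t v) = 0"
    by (simp add: heat_def)
  \<comment> \<open>An odd function has convolution 0 at the origin, so only the linear part
    survives: mass is conserved.\<close>
  have "heat_profile M t (\<lambda>r. Fm r v) 0 = M"
    using Gconv_minus[of "odd_ext (\<lambda>r. Fm r v - M * (1 - r))" 0 t 0] odd_ext_minus
    by (simp add: heat_profile_def)
  then have "Fm 0 (heat t v) = M"
    using heat_profile_eq(2)[OF v t, of 0] f by (simp add: Fm_0)
  moreover have "0 \<le> snd (heat t v) x" for x
    using v Gneum_nonneg[OF t] unfolding heat_def set_lebesgue_integral_def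
    by (auto simp: admissible_def indicator_def intro!: add_nonneg_nonneg Bochner_Integration.integral_nonneg)
  ultimately show "admissible M (heat t v)"
    using f heat_profile_eq(1)[OF v t, of 0] by (simp add: admissible_def)
  show "Fm r (heat t v) = heat_profile M t (\<lambda>r. Fm r v) r" if "0 < r" "r < 1" for r
    using heat_profile_eq(2)[OF v t, of r] that by (simp add: Fm_pos)
qed

section \<open>Barriers as iterated profile steps\<close>

lemma cut_profile_cong: "f r = g r \<Longrightarrow> cut_profile a f r = cut_profile a g r"
  by (simp add: cut_profile_def)

text \<open>Each cut is applied to the output of \<open>heat\<close>, which has no atom, so an atom
  left by the previous cut does no harm to \<open>Kcut_profile\<close>.\<close>

lemma Sminus_profile:
  assumes "admissible M (0, u)" "\<delta> > 0" "j > 0" "j * \<delta> < M"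
  shows "admissible M (Sminus j \<delta> k u) \<and>
    (\<forall>r. 0 < r \<longrightarrow> r < 1 \<longrightarrow> Fm r (Sminus j \<delta> k u) = (lower_step M j \<delta> ^^ k) (\<lambda>r. Fm r (0, u)) r)"
proof (induction k)
  case (Suc k)
  let ?v = "Sminus j \<delta> k u"
  have v: "admissible M ?v"
    using Suc by simp
  note h = heat_admissible[OF v \<open>\<delta> > 0\<close>]
  have a: "0 < j * \<delta>"
    using assms by simp
  have "heat_profile M \<delta> (\<lambda>r. Fm r ?v) = heat_profile M \<delta> ((lower_step M j \<delta> ^^ k) (\<lambda>r. Fm r (0, u)))"
    using Suc by (intro heat_profile_cong) auto
  then show ?case
    using Kcut_profile[OF h(1,2) a assms(4) refl] h(3)
    by (auto simp: lower_step_def[of M j \<delta> "(lower_step M j \<delta> ^^ k) (\<lambda>r. Fm r (0, u))"] intro!: cut_profile_cong)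
qed (simp add: assms)

text \<open>Here the cut comes first, so absence of an atom has to be part of the induction; it
  holds for the initial density and is restored by each heat step.\<close>

lemma Splus_profile:
  assumes "admissible M (0, u)" "\<delta> > 0" "j > 0" "j * \<delta> < M"
  shows "admissible M (Splus j \<delta> k u) \<and> fst (Splus j \<delta> k u) = 0 \<and>
    (\<forall>r. 0 < r \<longrightarrow> r < 1 \<longrightarrow> Fm r (Splus j \<delta> k u) = (upper_step M j \<delta> ^^ k) (\<lambda>r. Fm r (0, u)) r)"
proof (induction k)
  case (Suc k)
  let ?v = "Splus j \<delta> k u"
  have v: "admissible M ?v" "fst ?v = 0"
    using Suc by simp_all
  have a: "0 < j * \<delta>"
    using assms by simp
  note K = Kcut_profile[OF v a assms(4) refl]
  have "heat_profile M \<delta> (\<lambda>r. Fm r (Kcut j \<delta> ?v)) =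
      heat_profile M \<delta> (cut_profile (j * \<delta>) ((upper_step M j \<delta> ^^ k) (\<lambda>r. Fm r (0, u))))"
    using Suc K(2) by (intro heat_profile_cong) (auto intro!: cut_profile_cong)
  then show ?case
    using heat_admissible[OF K(1) \<open>\<delta> > 0\<close>] by (simp add: upper_step_def[of M j \<delta> "(upper_step M j \<delta> ^^ k) (\<lambda>r. Fm r (0, u))"])
qed (simp add: assms)

lemma admissible_bounded_density:
  assumes u: "set_borel_measurable lborel {0..1} u" "\<forall>x\<in>{0..1}. \<bar>u x\<bar> \<le> B" "\<forall>x\<in>{0..1}. u x \<ge> 0"
  shows "admissible (Fm 0 (0, u)) (0, u)"
proof -
  have "set_integrable lborel {0..1} u"
    unfolding set_integrable_def
  proof (rule Bochner_Integration.integrable_bound)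
    show "integrable lborel (\<lambda>x. indicator {0..1::real} x *\<^sub>R B)"
      by simp
  qed (use u in \<open>auto simp: set_borel_measurable_def indicator_def intro!: AE_I2 order_trans[OF _ abs_ge_self]\<close>)
  then show ?thesis
    using u(3) by (simp add: admissible_def)
qed

theorem mainTheorem2:
  fixes j :: real and u :: "real \<Rightarrow> real"
  assumes "j > 0"
    and "set_borel_measurable lborel {0..1} u"
    and "\<exists>B. \<forall>x\<in>{0..1}. \<bar>u x\<bar> \<le> B"
    and "\<forall>x\<in>{0..1}. u x \<ge> 0"
    and "Fm 0 (0, u) > 0"
  shows "\<forall>(\<delta>::real) (\<delta>'::real) (t::real) (k::nat) (k'::nat).
           \<delta> > 0 \<longrightarrow> \<delta>' > 0 \<longrightarrow>
           Fm 0 (0, u) > j * \<delta> \<longrightarrow> Fm 0 (0, u) > j * \<delta>' \<longrightarrow>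
           t = real k * \<delta> \<longrightarrow> t = real k' * \<delta>' \<longrightarrow>
           mt_le (Sminus j \<delta> k u) (Splus j \<delta>' k' u)"
proof (intro allI impI)
  fix \<delta> \<delta>' t :: real and k k' :: nat
  assume d: "\<delta> > 0" "\<delta>' > 0" "Fm 0 (0, u) > j * \<delta>" "Fm 0 (0, u) > j * \<delta>'"
    and t: "t = real k * \<delta>" "t = real k' * \<delta>'"
  let ?M = "Fm 0 (0, u)"
  have adm: "admissible ?M (0, u)"
    using assms(2-4) admissible_bounded_density by blast
  note minus = Sminus_profile[OF adm d(1) \<open>j > 0\<close> d(3), of k]
  note plus = Splus_profile[OF adm d(2) \<open>j > 0\<close> d(4), of k']
  have le: "profile_le ((lower_step ?M j \<delta> ^^ k) (\<lambda>r. Fm r (0, u))) ((upper_step ?M j \<delta>' ^^ k') (\<lambda>r. Fm r (0, u)))"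
    using assms(5) t d by (intro lower_steps_le_upper_steps admissible_profile[OF adm] \<open>j > 0\<close>) auto
  show "mt_le (Sminus j \<delta> k u) (Splus j \<delta>' k' u)"
    unfolding mt_le_def
  proof
    fix r :: real
    assume "r \<in> {0..1}"
    \<comment> \<open>Profiles decide only the open interval. At 0, where atoms count, both barriers
      have the common mass; at 1 both tails reduce to a single point and vanish.\<close>
    then consider "r = 0" | "r = 1" | "0 < r" "r < 1"
      by fastforce
    then show "Fm r (Sminus j \<delta> k u) \<le> Fm r (Splus j \<delta>' k' u)"
    proof cases
      case 1
      then show ?thesis
        using minus plus by (simp add: admissible_def)
    next
      case 2
      then show ?thesis
        by (simp add: Fm_1)
    next
      case 3
      then show ?thesis
        using minus plus le by (simp add: profile_le_def)
    qed
  qed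
qed

end
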